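(* Let $\bm{x}\in\mathbb{R}^n$ be a nonzero vector, let $\bm{a}_1,\dots,\bm{a}_m$ be i.i.d. $\mathcal{N}(\bm{0},\bm{I}_n)$ vectors, and let $\psi_i=|\bm{a}_i^{\mathsf T}\bm{x}|$ for $i=1,\dots,m$. Fix coefficients $\lambda^-<0$ and $\lambda^+>0$. Set $\hat r:=\sqrt{\frac1m\sum_{i=1}^m\psi_i^2}$, $\mathcal{I}^-:=\{i\in[m]:\psi_i^2\le \hat r^2/2\}$, $\mathcal{I}^+:=\{i\in[m]:\psi_i^2\ge\hat r^2/2\}$, and let $$\hat{\bm{d}}\in\arg\max_{\|\bm{z}\|_2=1}\ \bm{z}^{\mathsf T}\Big(\frac{\lambda^-}{|\mathcal{I}^-|}\sum_{i\in\mathcal{I}^-}\bm{a}_i\bm{a}_i^{\mathsf T}+\frac{\lambda^+}{|\mathcal{I}^+|}\sum_{i\in\mathcal{I}^+}\bm{a}_i\bm{a}_i^{\mathsf T}\Big)\bm{z},$$ and $\bm{z}_0:=\hat r\,\hat{\bm{d}}$. Then for any given constant $\delta_0\in(0,1)$ there exist numerical constants $c_0>0$ and $C_0$ such that, whenever $m\ge C_0 n$, with probability at least $1-10\exp(-c_0m)$, $$\mathrm{dist}(\bm{z}_0,\bm{x})\le\delta_0\|\bm{x}\|_2 .$$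
   Context: For $\bm{z},\bm{x}\in\mathbb{R}^n$, $\mathrm{dist}(\bm{z},\bm{x}):=\min\{\|\bm{z}+\bm{x}\|_2,\|\bm{z}-\bm{x}\|_2\}$. $[m]=\{1,\dots,m\}$. *)

theory Defs
  imports "HOL-Probability.Probability"
begin

text \<open>Vectors in R^n are represented as functions nat => real, only the
coordinates j < n being relevant. Samples: omega (i,j) is the j-th coordinate
of the Gaussian vector a_i (i < m, j < n).\<close>

definition vinner :: "nat \<Rightarrow> (nat \<Rightarrow> real) \<Rightarrow> (nat \<Rightarrow> real) \<Rightarrow> real" where
  "vinner n u v = (\<Sum>j<n. u j * v j)"

definition vnorm :: "nat \<Rightarrow> (nat \<Rightarrow> real) \<Rightarrow> real" where
  "vnorm n u = sqrt (vinner n u u)"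

definition pdist :: "nat \<Rightarrow> (nat \<Rightarrow> real) \<Rightarrow> (nat \<Rightarrow> real) \<Rightarrow> real" where
  "pdist n z x = min (vnorm n (\<lambda>j. z j + x j)) (vnorm n (\<lambda>j. z j - x j))"

definition std_gauss :: "real measure" where
  "std_gauss = density lborel std_normal_density"

definition gauss_sample :: "nat \<Rightarrow> nat \<Rightarrow> (nat \<times> nat \<Rightarrow> real) measure" where
  "gauss_sample m n = PiM ({..<m} \<times> {..<n}) (\<lambda>_. std_gauss)"

definition avec :: "(nat \<times> nat \<Rightarrow> real) \<Rightarrow> nat \<Rightarrow> nat \<Rightarrow> real" where
  "avec \<omega> i = (\<lambda>j. \<omega> (i, j))"

definition psi :: "nat \<Rightarrow> (nat \<times> nat \<Rightarrow> real) \<Rightarrow> (nat \<Rightarrow> real) \<Rightarrow> nat \<Rightarrow> real" where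
  "psi n \<omega> x i = \<bar>vinner n (avec \<omega> i) x\<bar>"

definition rhat :: "nat \<Rightarrow> nat \<Rightarrow> (nat \<times> nat \<Rightarrow> real) \<Rightarrow> (nat \<Rightarrow> real) \<Rightarrow> real" where
  "rhat m n \<omega> x = sqrt ((1 / real m) * (\<Sum>i<m. (psi n \<omega> x i)\<^sup>2))"

definition Iminus :: "nat \<Rightarrow> nat \<Rightarrow> (nat \<times> nat \<Rightarrow> real) \<Rightarrow> (nat \<Rightarrow> real) \<Rightarrow> nat set" where
  "Iminus m n \<omega> x = {i \<in> {..<m}. (psi n \<omega> x i)\<^sup>2 \<le> (rhat m n \<omega> x)\<^sup>2 / 2}"

definition Iplus :: "nat \<Rightarrow> nat \<Rightarrow> (nat \<times> nat \<Rightarrow> real) \<Rightarrow> (nat \<Rightarrow> real) \<Rightarrow> nat set" where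
  "Iplus m n \<omega> x = {i \<in> {..<m}. (psi n \<omega> x i)\<^sup>2 \<ge> (rhat m n \<omega> x)\<^sup>2 / 2}"

text \<open>z^T Y z for Y = lm/|I-| sum_{I-} a_i a_i^T + lp/|I+| sum_{I+} a_i a_i^T\<close>
definition quadY :: "real \<Rightarrow> real \<Rightarrow> nat \<Rightarrow> nat \<Rightarrow> (nat \<times> nat \<Rightarrow> real) \<Rightarrow> (nat \<Rightarrow> real)
    \<Rightarrow> (nat \<Rightarrow> real) \<Rightarrow> real" where
  "quadY lm lp m n \<omega> x z =
     lm / real (card (Iminus m n \<omega> x)) * (\<Sum>i\<in>Iminus m n \<omega> x. (vinner n (avec \<omega> i) z)\<^sup>2)
   + lp / real (card (Iplus m n \<omega> x)) * (\<Sum>i\<in>Iplus m n \<omega> x. (vinner n (avec \<omega> i) z)\<^sup>2)"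

definition unit_sphere_n :: "nat \<Rightarrow> (nat \<Rightarrow> real) set" where
  "unit_sphere_n n = {z. (\<forall>j\<ge>n. z j = 0) \<and> vnorm n z = 1}"

definition is_dhat :: "real \<Rightarrow> real \<Rightarrow> nat \<Rightarrow> nat \<Rightarrow> (nat \<times> nat \<Rightarrow> real) \<Rightarrow> (nat \<Rightarrow> real)
    \<Rightarrow> (nat \<Rightarrow> real) \<Rightarrow> bool" where
  "is_dhat lm lp m n \<omega> x d \<longleftrightarrow> d \<in> unit_sphere_n n \<and>
     (\<forall>z\<in>unit_sphere_n n. quadY lm lp m n \<omega> x z \<le> quadY lm lp m n \<omega> x d)"

end

theory Submission
  imports Defs
begin

text \<open>Put \<open>e = x / |x|\<close>, \<open>X\<^sub>i = \<langle>a\<^sub>i, e\<rangle>\<close> and \<open>R = (\<Sum>\<^sub>i X\<^sub>i\<^sup>2) / m\<close>. The index sets \<open>L = {X\<^sub>i\<^sup>2 \<le> R/2}\<close> and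
  \<open>H = {X\<^sub>i\<^sup>2 \<ge> R/2}\<close> depend on \<open>X\<close> only, and the average of \<open>X\<^sub>i\<^sup>2\<close> is at most \<open>R/2\<close> over \<open>L\<close> and at least \<open>R\<close>
  over \<open>H\<close>. For \<open>w\<close> orthogonal to \<open>e\<close> the variables \<open>\<langle>a\<^sub>i, w\<rangle>\<close> are independent of \<open>X\<close>, so conditionally on \<open>X\<close>
  the averages of \<open>\<langle>a\<^sub>i, w\<rangle>\<^sup>2\<close> over \<open>L\<close> and \<open>H\<close> concentrate at 1 and those of \<open>X\<^sub>i \<langle>a\<^sub>i, w\<rangle>\<close> at 0; a net of
  exponential cardinality makes this uniform in \<open>w\<close>. As \<open>R\<close> is close to 1, the quadratic form at \<open>e\<close> exceeds
  its value at every such \<open>w\<close> by a fixed gap while the cross terms are small, which forces the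
  maximizer to be close to \<open>\<plusminus>e\<close>.\<close>

section \<open>Vectors and seminorms\<close>

text \<open>The sets \<open>L\<close> and \<open>H\<close> are random and their threshold couples
  all samples, so sums over them are not sums of independent terms until \<open>X\<close> is frozen.
  The conditional bounds then have a rate of order \<open>m\<close> only if both sets hold a fixed
  fraction of the samples and the sum of the squares of \<open>X\<close> is of order
  \<open>m\<close>. Hence balance is asked for only on the event \<open>regular\<close>, and that
  event is secured by counting the \<open>X i\<close> in fixed intervals, which does not involve the
  random threshold. In the model only the coordinates are independent. That the components along
  \<open>e\<close> and \<open>w\<close> are independent too is derived from joint characteristic
  functions. The gap of the quadratic form is a multiple of \<open>- lm\<close>, while the errors
  are multiples of \<open>\<epsilon> * (lp - lm)\<close>. So \<epsilon> is taken proportional to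
  \<open>\<delta>0 * (- lm) / (lp - lm)\<close>, and all constants depend on the coefficients and on
  \<delta>0, but not on \<open>m\<close>, \<open>n\<close> or \<open>x\<close>.\<close>

lemma vinner_commute: "vinner n u v = vinner n v u"
  by (simp add: vinner_def mult.commute)

lemma vinner_add_right: "vinner n u (\<lambda>j. v j + w j) = vinner n u v + vinner n u w"
  by (simp add: vinner_def distrib_left sum.distrib)

lemma vinner_diff_right: "vinner n u (\<lambda>j. v j - w j) = vinner n u v - vinner n u w"
  by (simp add: vinner_def right_diff_distrib sum_subtractf)

lemma vinner_scale_right: "vinner n u (\<lambda>j. c * v j) = c * vinner n u v"
  by (simp add: vinner_def sum_distrib_left mult.left_commute)

lemma vinner_self_nonneg: "0 \<le> vinner n u u"
  by (simp add: vinner_def sum_nonneg)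

lemma vnorm_L2_set: "vnorm n u = L2_set u {..<n}"
  by (simp add: vnorm_def L2_set_def vinner_def power2_eq_square)

lemma vnorm_nonneg: "0 \<le> vnorm n u"
  by (simp add: vnorm_def vinner_self_nonneg)

lemma vnorm_power2: "(vnorm n u)\<^sup>2 = vinner n u u"
  by (simp add: vnorm_def vinner_self_nonneg)

lemma vnorm_triangle: "vnorm n (\<lambda>j. u j + v j) \<le> vnorm n u + vnorm n v"
  unfolding vnorm_L2_set by (rule L2_set_triangle_ineq)

lemma vnorm_scale: "vnorm n (\<lambda>j. c * u j) = \<bar>c\<bar> * vnorm n u"
  unfolding vnorm_def vinner_def
  by (simp add: power_mult_distrib sum_distrib_left[symmetric] real_sqrt_mult flip: power2_eq_square)

lemma vinner_Cauchy_Schwarz: "\<bar>vinner n u v\<bar> \<le> vnorm n u * vnorm n v"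
proof -
  have "\<bar>vinner n u v\<bar> \<le> (\<Sum>j<n. \<bar>u j\<bar> * \<bar>v j\<bar>)"
    unfolding vinner_def by (rule order_trans[OF sum_abs]) (simp add: abs_mult)
  also have "\<dots> \<le> vnorm n u * vnorm n v"
    unfolding vnorm_L2_set by (rule L2_set_mult_ineq)
  finally show ?thesis .
qed

definition perp :: "nat \<Rightarrow> (nat \<Rightarrow> real) \<Rightarrow> (nat \<Rightarrow> real) \<Rightarrow> nat \<Rightarrow> real" where
  "perp n e z = (\<lambda>j. z j - vinner n z e * e j)"

lemma vinner_perp:
  assumes "vnorm n e = 1"
  shows "vinner n e (perp n e z) = 0"
proof -
  have "vinner n e e = 1" using assms vnorm_power2[of n e] by simp
  then show ?thesis
    by (simp add: perp_def vinner_diff_right vinner_scale_right vinner_commute)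
qed

lemma vnorm_perp:
  assumes "vnorm n e = 1"
  shows "(vnorm n (perp n e z))\<^sup>2 = (vnorm n z)\<^sup>2 - (vinner n z e)\<^sup>2"
proof -
  have e: "vinner n e e = 1" using assms vnorm_power2[of n e] by simp
  have "vinner n (perp n e z) (perp n e z)
      = vinner n (perp n e z) z - vinner n z e * vinner n (perp n e z) e"
    unfolding perp_def[of n e z] vinner_diff_right vinner_scale_right ..
  also have "vinner n (perp n e z) e = 0"
    using vinner_perp[OF assms] by (simp add: vinner_commute)
  also have "vinner n (perp n e z) z = vinner n z z - (vinner n z e)\<^sup>2"
    unfolding vinner_commute[of n "perp n e z" z]
    by (simp add: perp_def vinner_diff_right vinner_scale_right power2_eq_square)
  finally show ?thesis by (simp add: vnorm_power2)
qed

lemma vnorm_perp_le: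
  assumes "vnorm n e = 1"
  shows "vnorm n (perp n e z) \<le> vnorm n z"
  by (rule power2_le_imp_le) (simp_all add: vnorm_perp[OF assms] vnorm_nonneg)

text \<open>With \<open>M\<close> the supremum of \<open>p\<close> on the unit sphere of
  \<open>W\<close>, approximation by net points gives
  \<open>M \<le> b * (1 + \<delta>) + \<delta> * M\<close>, which can be solved for \<open>M\<close>
  because \<open>bdd\<close> makes it finite. Net points may have any norm, so their bounds are
  stated per unit of norm; the difference has to lie in \<open>W\<close> for \<open>M\<close> to
  control it.\<close>

lemma seminorm_net_bound:
  fixes p :: "(nat \<Rightarrow> real) \<Rightarrow> real"
  assumes add: "\<And>u v. p (\<lambda>j. u j + v j) \<le> p u + p v"
    and scale: "\<And>c u. p (\<lambda>j. c * u j) = \<bar>c\<bar> * p u"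
    and bdd: "\<And>u. p u \<le> C * vnorm n u"
    and net: "\<And>z. z \<in> W \<Longrightarrow> vnorm n z = 1 \<Longrightarrow>
        \<exists>y. y \<in> W \<and> (\<lambda>j. z j - y j) \<in> W \<and> vnorm n (\<lambda>j. z j - y j) \<le> \<delta>
            \<and> a * vnorm n y \<le> p y \<and> p y \<le> b * vnorm n y"
    and W: "\<And>z c. z \<in> W \<Longrightarrow> (\<lambda>j. c * z j) \<in> W"
    and \<delta>: "0 \<le> \<delta>" "\<delta> < 1" and ab: "0 \<le> a" "0 \<le> b"
    and z: "z \<in> W" "vnorm n z = 1"
  shows "p z \<le> b * (1 + \<delta>) / (1 - \<delta>)"
    and "a * (1 - \<delta>) - \<delta> * (b * (1 + \<delta>) / (1 - \<delta>)) \<le> p z"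
proof -
  define U where "U = {z \<in> W. vnorm n z = 1}"
  define M where "M = (SUP z\<in>U. p z)"
  have bddU: "bdd_above (p ` U)"
  proof (rule bdd_aboveI2)
    show "p u \<le> C" if "u \<in> U" for u using bdd[of u] that by (simp add: U_def)
  qed
  have pM: "p u \<le> M" if "u \<in> U" for u
    unfolding M_def by (rule cSUP_upper[OF that bddU])
  have pMW: "p u \<le> M * vnorm n u" if "u \<in> W" for u
  proof (cases "vnorm n u = 0")
    case True
    then show ?thesis using bdd[of u] by simp
  next
    case False
    define v where "v = (\<lambda>j. (1 / vnorm n u) * u j)"
    have "v \<in> U"
      using W[OF that, of "1 / vnorm n u"] False vnorm_scale[of n "1 / vnorm n u" u]
      by (simp add: U_def v_def vnorm_nonneg)
    then have "p v \<le> M" by (rule pM)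
    moreover have "p v = p u / vnorm n u"
      using False scale[of "1 / vnorm n u" u] by (simp add: v_def vnorm_nonneg)
    ultimately show ?thesis
      using False vnorm_nonneg[of n u] by (simp add: divide_simps split: if_splits)
  qed
  have zero: "p u \<ge> 0" for u
  proof -
    have "p (\<lambda>j. u j + (-1) * u j) \<le> p u + p u"
      using add[of u "\<lambda>j. (-1) * u j"] scale[of "-1" u] by simp
    moreover have "p (\<lambda>j. 0 * u j) = 0" by (subst scale) simp
    ultimately show ?thesis by simp
  qed
  have M0: "0 \<le> M" using pM[of z] zero[of z] z by (simp add: U_def)
  have key: "p u \<le> b * (1 + \<delta>) + \<delta> * M \<and> a * (1 - \<delta>) - \<delta> * M \<le> p u"
    if u: "u \<in> U" for u
  proof -
    obtain y where y: "y \<in> W" "(\<lambda>j. u j - y j) \<in> W" "vnorm n (\<lambda>j. u j - y j) \<le> \<delta>"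
      "a * vnorm n y \<le> p y" "p y \<le> b * vnorm n y"
      using net u by (auto simp: U_def)
    have pd: "p (\<lambda>j. u j - y j) \<le> \<delta> * M"
      using pMW[OF y(2)] mult_left_mono[OF y(3) M0] by (simp add: mult.commute)
    have pd': "p (\<lambda>j. y j - u j) \<le> \<delta> * M"
      using pd scale[of "-1" "\<lambda>j. u j - y j"] by simp
    have ny: "vnorm n y \<le> 1 + \<delta>"
    proof -
      have "vnorm n y \<le> vnorm n u + vnorm n (\<lambda>j. y j - u j)"
        using vnorm_triangle[of n u "\<lambda>j. y j - u j"] by simp
      moreover have "vnorm n (\<lambda>j. y j - u j) = vnorm n (\<lambda>j. u j - y j)"
        using vnorm_scale[of n "-1" "\<lambda>j. u j - y j"] by simp
      ultimately show ?thesis using u y(3) by (simp add: U_def)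
    qed
    have ny': "1 - \<delta> \<le> vnorm n y"
      using vnorm_triangle[of n y "\<lambda>j. u j - y j"] u y(3) by (simp add: U_def)
    have "p u \<le> p y + p (\<lambda>j. u j - y j)" using add[of y "\<lambda>j. u j - y j"] by simp
    moreover have "p y \<le> p u + p (\<lambda>j. y j - u j)" using add[of u "\<lambda>j. y j - u j"] by simp
    ultimately show ?thesis
      using pd pd' y(4,5) mult_left_mono[OF ny ab(2)] mult_left_mono[OF ny' ab(1)] by linarith
  qed
  have "M \<le> b * (1 + \<delta>) + \<delta> * M"
    unfolding M_def using z key by (intro cSUP_least) (auto simp: U_def M_def)
  then have M: "M \<le> b * (1 + \<delta>) / (1 - \<delta>)"
    using \<delta> by (simp add: field_simps)
  show "p z \<le> b * (1 + \<delta>) / (1 - \<delta>)"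
    using M pM[of z] z by (simp add: U_def)
  show "a * (1 - \<delta>) - \<delta> * (b * (1 + \<delta>) / (1 - \<delta>)) \<le> p z"
    using key[of z] z mult_left_mono[OF M \<delta>(1)] by (simp add: U_def)
qed

section \<open>A net of the sphere\<close>

text \<open>With \<open>K = k\<^sup>2 * n\<close> and the scaling of \<open>gridvec\<close> these
  are the points of the closed unit ball in a lattice of mesh \<open>1 / (k * sqrt n)\<close>. The
  box of extensional functions gives finiteness, and sums of products over it factor.\<close>

definition grid :: "nat \<Rightarrow> nat \<Rightarrow> (nat \<Rightarrow> int) set" where
  "grid n K = {v \<in> {..<n} \<rightarrow>\<^sub>E {- int K..int K}. (\<Sum>j<n. (v j)\<^sup>2) \<le> int K}"

lemma finite_grid: "finite (grid n K)"
proof (rule finite_subset)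
  show "grid n K \<subseteq> {..<n} \<rightarrow>\<^sub>E {- int K..int K}" by (auto simp: grid_def)
qed (intro finite_PiE; simp)

lemma sum_half_powers_abs:
  "(\<Sum>c\<in>{- int K..int K}. (1/2) ^ nat \<bar>c\<bar>) = (3 - 2 * (1/2) ^ K :: real)"
proof (induction K)
  case 0
  then show ?case by simp
next
  case (Suc K)
  have "{- int (Suc K)..int (Suc K)} = insert (- int (Suc K)) (insert (int (Suc K)) {- int K..int K})"
    by auto
  then have "(\<Sum>c\<in>{- int (Suc K)..int (Suc K)}. (1/2) ^ nat \<bar>c\<bar>)
      = (1/2) ^ Suc K + ((1/2) ^ Suc K + (\<Sum>c\<in>{- int K..int K}. (1/2) ^ nat \<bar>c\<bar>) :: real)"
    by (simp add: nat_add_distrib)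
  then show ?case using Suc.IH by simp
qed

text \<open>Each grid point carries weight at least \<open>2\<^sup>-\<^sup>K\<close> under the product weight
  \<open>\<Prod>\<^sub>j 2\<^bsup>-|v j|\<^esup>\<close>, whose total mass is at most \<open>3\<^sup>n\<close>.\<close>

lemma card_grid: "real (card (grid n K)) \<le> 2 ^ K * 3 ^ n"
proof -
  have w: "(1/2) ^ K \<le> (\<Prod>j<n. (1/2) ^ nat \<bar>v j\<bar> :: real)" if "v \<in> grid n K" for v
  proof -
    have le: "\<bar>c\<bar> \<le> c\<^sup>2" for c :: int
      using self_le_power[of "\<bar>c\<bar>" 2] by (cases "c = 0") auto
    have "int (\<Sum>j<n. nat \<bar>v j\<bar>) = (\<Sum>j<n. \<bar>v j\<bar>)" by simp
    also have "\<dots> \<le> (\<Sum>j<n. (v j)\<^sup>2)" by (intro sum_mono le)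
    also have "\<dots> \<le> int K" using that by (simp add: grid_def)
    finally have "(\<Sum>j<n. nat \<bar>v j\<bar>) \<le> K" by linarith
    then have "(1/2) ^ K \<le> (1/2 :: real) ^ (\<Sum>j<n. nat \<bar>v j\<bar>)"
      by (intro power_decreasing) auto
    then show ?thesis by (simp add: power_sum)
  qed
  have "real (card (grid n K)) * (1/2) ^ K = (\<Sum>v\<in>grid n K. (1/2) ^ K)" by simp
  also have "\<dots> \<le> (\<Sum>v\<in>grid n K. \<Prod>j<n. (1/2) ^ nat \<bar>v j\<bar>)" by (intro sum_mono w)
  also have "\<dots> \<le> (\<Sum>v\<in>{..<n} \<rightarrow>\<^sub>E {- int K..int K}. \<Prod>j<n. (1/2) ^ nat \<bar>v j\<bar>)"
    by (intro sum_mono2 finite_PiE prod_nonneg) (auto simp: grid_def)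
  also have "\<dots> = (\<Prod>j<n. \<Sum>c\<in>{- int K..int K}. (1/2) ^ nat \<bar>c\<bar>)"
    by (subst prod_sum_PiE) auto
  also have "\<dots> = (3 - 2 * (1/2) ^ K) ^ n" by (simp add: sum_half_powers_abs)
  also have "\<dots> \<le> 3 ^ n"
  proof (rule power_mono)
    have "(1/2 :: real) ^ K \<le> 1" by (rule power_le_one) auto
    then show "0 \<le> 3 - 2 * (1/2 :: real) ^ K" by linarith
  qed simp
  finally show ?thesis by (simp add: field_simps power_divide)
qed

definition gridvec :: "nat \<Rightarrow> nat \<Rightarrow> (nat \<Rightarrow> int) \<Rightarrow> nat \<Rightarrow> real" where
  "gridvec n k v j = real_of_int (v j) / (real k * sqrt (real n))"

text \<open>Rounding moves each scaled coordinate by at most 1, so the squared error is at most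
  \<open>n / N\<^sup>2 = 1 / k\<^sup>2\<close>.\<close>

lemma grid_approx:
  assumes n: "0 < n" and k: "0 < k" and z: "vnorm n z = 1"
  shows "\<exists>v\<in>grid n (k\<^sup>2 * n). vnorm n (\<lambda>j. z j - gridvec n k v j) \<le> 1 / real k"
proof -
  define N where "N = real k * sqrt (real n)"
  have N: "N > 0" "N\<^sup>2 = real (k\<^sup>2 * n)" using n k by (simp_all add: N_def power_mult_distrib)
  \<comment> \<open>Rounding goes towards zero: absolute values do not increase, so the rounded
    vector stays in the ball that defines the grid.\<close>
  define r where "r t = (if t \<ge> 0 then \<lfloor>t\<rfloor> else \<lceil>t\<rceil>)" for t :: real
  have r1: "\<bar>real_of_int (r t)\<bar> \<le> \<bar>t\<bar>" for t
  proof (cases "t \<ge> 0")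
    case True
    then have "0 \<le> real_of_int \<lfloor>t\<rfloor>" by simp
    with True show ?thesis using of_int_floor_le[of t] by (simp add: r_def)
  next
    case False
    then have "real_of_int \<lceil>t\<rceil> \<le> 0" by simp
    with False show ?thesis using le_of_int_ceiling[of t] by (simp add: r_def)
  qed
  have r2: "\<bar>t - real_of_int (r t)\<bar> \<le> 1" for t
  proof (cases "t \<ge> 0")
    case True
    then show ?thesis unfolding r_def by simp linarith
  next
    case False
    then show ?thesis unfolding r_def by simp linarith
  qed
  define v where "v = (\<lambda>j\<in>{..<n}. r (N * z j))"
  have zz: "(\<Sum>j<n. (z j)\<^sup>2) = 1"
    using z vnorm_power2[of n z] by (simp add: vinner_def power2_eq_square)
  have "real_of_int (\<Sum>j<n. (v j)\<^sup>2) = (\<Sum>j<n. (real_of_int (r (N * z j)))\<^sup>2)" by (simp add: v_def)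
  also have "\<dots> \<le> (\<Sum>j<n. (N * z j)\<^sup>2)"
    using r1 by (intro sum_mono) (simp add: abs_le_square_iff)
  also have "\<dots> = N\<^sup>2" using zz by (simp add: power_mult_distrib flip: sum_distrib_left)
  finally have sum: "(\<Sum>j<n. (v j)\<^sup>2) \<le> int (k\<^sup>2 * n)" unfolding N by linarith
  have "\<bar>v j\<bar> \<le> int (k\<^sup>2 * n)" if "j < n" for j
  proof -
    have "\<bar>v j\<bar> \<le> (v j)\<^sup>2"
      using self_le_power[of "\<bar>v j\<bar>" 2] by (cases "v j = 0") auto
    also have "\<dots> \<le> (\<Sum>j<n. (v j)\<^sup>2)" using that by (intro member_le_sum) auto
    finally show ?thesis using sum by linarith
  qed
  then have "v j \<in> {- int (k\<^sup>2 * n)..int (k\<^sup>2 * n)}" if "j < n" for j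
    using that unfolding atLeastAtMost_iff by (meson abs_le_iff minus_le_iff)
  then have mem: "v \<in> grid n (k\<^sup>2 * n)"
    using sum by (auto simp: grid_def v_def restrict_def extensional_def PiE_def)
  have "(vnorm n (\<lambda>j. z j - gridvec n k v j))\<^sup>2 = (\<Sum>j<n. (z j - gridvec n k v j)\<^sup>2)"
    unfolding vnorm_power2 vinner_def by (simp add: power2_eq_square)
  also have "\<dots> \<le> (\<Sum>j<n. 1 / N\<^sup>2)"
  proof (intro sum_mono)
    fix j assume "j \<in> {..<n}"
    then have "z j - gridvec n k v j = (N * z j - real_of_int (r (N * z j))) / N"
      using N by (simp add: gridvec_def v_def N_def[symmetric] field_simps)
    then show "(z j - gridvec n k v j)\<^sup>2 \<le> 1 / N\<^sup>2"
      using r2[of "N * z j"] N(1)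
      by (simp add: power_divide divide_right_mono abs_square_le_1)
  qed
  also have "\<dots> = (1 / real k)\<^sup>2" using n k N(2) by (simp add: power_divide)
  finally have "vnorm n (\<lambda>j. z j - gridvec n k v j) \<le> 1 / real k"
    by (rule power2_le_imp_le) simp
  with mem show ?thesis by blast
qed

section \<open>Uniform balance on the orthogonal complement of \<open>e\<close>\<close>

text \<open>Projecting the grid keeps the net inside the complement of \<open>e\<close>, where
  independence of \<open>X\<close> is available, and increases no distance. The projected points
  need not be unit vectors and may vanish.\<close>

definition netvec :: "nat \<Rightarrow> nat \<Rightarrow> (nat \<Rightarrow> real) \<Rightarrow> (nat \<Rightarrow> int) \<Rightarrow> nat \<Rightarrow> real" where
  "netvec n k e v = perp n e (gridvec n k v)"

text \<open>The bounds carry the factor \<open>card S\<close> instead of dividing by it, so an empty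
  \<open>S\<close> needs no special treatment.\<close>

definition balanced :: "real \<Rightarrow> nat set \<Rightarrow> (nat \<Rightarrow> real) \<Rightarrow> (nat \<Rightarrow> real) \<Rightarrow> bool" where
  "balanced \<epsilon> S X Y \<longleftrightarrow> \<bar>(\<Sum>i\<in>S. (Y i)\<^sup>2) - real (card S)\<bar> \<le> \<epsilon> * real (card S) \<and>
     \<bar>\<Sum>i\<in>S. X i * Y i\<bar> \<le> \<epsilon> * real (card S)"

text \<open>The root of the sum of squares and the absolute value of the cross sum are seminorms in
  \<open>z\<close>, so each extends from the net to the whole sphere. Taking the root, extending and
  squaring again enlarges the relative error \<epsilon> to at most
  \<open>10 * \<epsilon>\<close>.\<close>

lemma balanced_of_net:
  assumes n: "0 < n" and k: "0 < k" "1 / real k \<le> \<epsilon>" and \<epsilon>: "\<epsilon> \<le> 1/10"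
    and S: "finite S" and e: "vnorm n e = 1"
    and net: "\<And>v. v \<in> grid n (k\<^sup>2 * n) \<Longrightarrow> vnorm n (netvec n k e v) \<noteq> 0 \<Longrightarrow>
      balanced \<epsilon> S x (\<lambda>i. vinner n (a i) (\<lambda>j. netvec n k e v j / vnorm n (netvec n k e v)))"
    and z: "vinner n e z = 0" "vnorm n z = 1"
  shows "balanced (10 * \<epsilon>) S x (\<lambda>i. vinner n (a i) z)"
proof -
  define s where "s = sqrt (real (card S))"
  have s: "s \<ge> 0" "s\<^sup>2 = card S" by (simp_all add: s_def)
  have \<epsilon>0: "0 < \<epsilon>" using k by (meson less_le_trans of_nat_0_less_iff zero_less_divide_1_iff)
  define p where "p z = L2_set (\<lambda>i. vinner n (a i) z) S" for z
  define q where "q z = \<bar>\<Sum>i\<in>S. x i * vinner n (a i) z\<bar>" for z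
  have p2: "(p z)\<^sup>2 = (\<Sum>i\<in>S. (vinner n (a i) z)\<^sup>2)" for z
    by (simp add: p_def L2_set_def sum_nonneg)
  have p0: "0 \<le> p z" for z by (simp add: p_def)
  have padd: "p (\<lambda>j. u j + v j) \<le> p u + p v" for u v
    unfolding p_def vinner_add_right by (rule L2_set_triangle_ineq)
  have pscale: "p (\<lambda>j. c * u j) = \<bar>c\<bar> * p u" for c u
    unfolding p_def vinner_scale_right L2_set_def
    by (simp add: power_mult_distrib real_sqrt_mult flip: sum_distrib_left)
  have pbdd: "p u \<le> (\<Sum>i\<in>S. vnorm n (a i)) * vnorm n u" for u
  proof -
    have "p u \<le> (\<Sum>i\<in>S. \<bar>vinner n (a i) u\<bar>)" unfolding p_def by (rule L2_set_le_sum_abs)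
    also have "\<dots> \<le> (\<Sum>i\<in>S. vnorm n (a i) * vnorm n u)" by (intro sum_mono vinner_Cauchy_Schwarz)
    finally show ?thesis by (simp add: sum_distrib_right)
  qed
  have qadd: "q (\<lambda>j. u j + v j) \<le> q u + q v" for u v
    unfolding q_def vinner_add_right distrib_left sum.distrib by (rule abs_triangle_ineq)
  have qscale: "q (\<lambda>j. c * u j) = \<bar>c\<bar> * q u" for c u
    unfolding q_def vinner_scale_right mult.left_commute[of _ c]
    by (simp add: abs_mult flip: sum_distrib_left)
  have qbdd: "q u \<le> (\<Sum>i\<in>S. \<bar>x i\<bar> * vnorm n (a i)) * vnorm n u" for u
  proof -
    have "q u \<le> (\<Sum>i\<in>S. \<bar>x i * vinner n (a i) u\<bar>)" unfolding q_def by (rule sum_abs)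
    also have "\<dots> \<le> (\<Sum>i\<in>S. \<bar>x i\<bar> * (vnorm n (a i) * vnorm n u))"
      unfolding abs_mult by (intro sum_mono mult_left_mono vinner_Cauchy_Schwarz) auto
    finally show ?thesis by (simp add: sum_distrib_right mult.assoc)
  qed
  define W where "W = {z. vinner n e z = 0}"
  have Wscale: "(\<lambda>j. c * z j) \<in> W" if "z \<in> W" for z c
    using that by (simp add: W_def vinner_scale_right)
  have zW: "z \<in> W" using z by (simp add: W_def)
  \<comment> \<open>One net point serves both seminorms. The lower constant for \<open>q\<close> is
    0, because only its smallness matters.\<close>
  have net': "\<exists>y. y \<in> W \<and> (\<lambda>j. z j - y j) \<in> W \<and> vnorm n (\<lambda>j. z j - y j) \<le> \<epsilon>
      \<and> ((1 - \<epsilon>) * s * vnorm n y \<le> p y \<and> p y \<le> (1 + \<epsilon>) * s * vnorm n y)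
      \<and> (0 * vnorm n y \<le> q y \<and> q y \<le> \<epsilon> * card S * vnorm n y)"
    if z: "z \<in> W" "vnorm n z = 1" for z
  proof -
    obtain v where v: "v \<in> grid n (k\<^sup>2 * n)" "vnorm n (\<lambda>j. z j - gridvec n k v j) \<le> 1 / real k"
      using grid_approx[OF n k(1) z(2)] by blast
    define y where "y = netvec n k e v"
    have yW: "y \<in> W" by (simp add: W_def y_def netvec_def vinner_perp[OF e])
    \<comment> \<open>\<open>z\<close> is its own projection, so by linearity the error is the
      projection of the grid error.\<close>
    have "(\<lambda>j. z j - y j) = perp n e (\<lambda>j. z j - gridvec n k v j)"
    proof
      fix j
      have "vinner n (\<lambda>j. z j - gridvec n k v j) e = - vinner n (gridvec n k v) e"
        using z by (simp add: vinner_commute[of n _ e] vinner_diff_right W_def)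
      then show "z j - y j = perp n e (\<lambda>j. z j - gridvec n k v j) j"
        by (simp add: y_def netvec_def perp_def)
    qed
    then have d: "vnorm n (\<lambda>j. z j - y j) \<le> \<epsilon>"
      using vnorm_perp_le[OF e, of "\<lambda>j. z j - gridvec n k v j"] v(2) k(2) by simp
    have "(1 - \<epsilon>) * s * vnorm n y \<le> p y \<and> p y \<le> (1 + \<epsilon>) * s * vnorm n y
        \<and> q y \<le> \<epsilon> * card S * vnorm n y"
    proof (cases "vnorm n y = 0")
      case True
      then show ?thesis using p0[of y] pbdd[of y] qbdd[of y] by simp
    next
      case False
      define w where "w = (\<lambda>j. (1 / vnorm n y) * y j)"
      have wni: "balanced \<epsilon> S x (\<lambda>i. vinner n (a i) w)"
        using net[OF v(1)] False by (simp add: w_def y_def)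
      have pos: "vnorm n y > 0" using False vnorm_nonneg[of n y] by simp
      have pw: "p y = p w * vnorm n y" and qw: "q y = q w * vnorm n y"
        using pos unfolding w_def pscale qscale by simp_all
      have "(1 - \<epsilon>) * card S \<le> (p w)\<^sup>2" "(p w)\<^sup>2 \<le> (1 + \<epsilon>) * card S"
        using wni by (auto simp: balanced_def p2 abs_le_iff algebra_simps)
      \<comment> \<open>These comparisons turn the bounds on the square of \<open>p w\<close> into
        bounds on \<open>p w\<close> with factors \<open>1 - \<epsilon>\<close> and
        \<open>1 + \<epsilon>\<close>.\<close>
      moreover have "(1 - \<epsilon>)\<^sup>2 \<le> 1 - \<epsilon>" "1 + \<epsilon> \<le> (1 + \<epsilon>)\<^sup>2"
        using \<epsilon> \<epsilon>0 by (auto simp: power2_eq_square mult_left_le algebra_simps)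
      ultimately have "((1 - \<epsilon>) * s)\<^sup>2 \<le> (p w)\<^sup>2" "(p w)\<^sup>2 \<le> ((1 + \<epsilon>) * s)\<^sup>2"
        unfolding power_mult_distrib s(2)
        by (meson mult_right_mono of_nat_0_le_iff order_trans)+
      then have "(1 - \<epsilon>) * s \<le> p w" "p w \<le> (1 + \<epsilon>) * s"
        using p0[of w] s(1) \<epsilon> \<epsilon>0 by (auto intro: power2_le_imp_le)
      moreover have "q w \<le> \<epsilon> * card S" using wni by (simp add: balanced_def q_def)
      ultimately show ?thesis unfolding pw qw using pos by (simp add: mult_right_mono)
    qed
    moreover have "(\<lambda>j. z j - y j) \<in> W" using z yW by (simp add: W_def vinner_diff_right)
    moreover have "0 \<le> q y" by (simp add: q_def)
    ultimately show ?thesis using yW d by auto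
  qed
  have r: "(1 + \<epsilon>) * (1 + \<epsilon>) / (1 - \<epsilon>) \<le> 1 + 4 * \<epsilon>"
  proof -
    have "\<epsilon> * (5 * \<epsilon>) \<le> \<epsilon> * 1" using \<epsilon> \<epsilon>0 by (intro mult_left_mono) auto
    then show ?thesis using \<epsilon> by (simp add: field_simps)
  qed
  have pz1: "p z \<le> (1 + \<epsilon>) * s * (1 + \<epsilon>) / (1 - \<epsilon>)"
    by (rule seminorm_net_bound(1)[OF padd pscale pbdd _ Wscale _ _ _ _ zW z(2), where a="(1 - \<epsilon>) * s"];
        use net' \<epsilon> \<epsilon>0 s in \<open>force\<close>)
  have pz2: "(1 - \<epsilon>) * s * (1 - \<epsilon>) - \<epsilon> * ((1 + \<epsilon>) * s * (1 + \<epsilon>) / (1 - \<epsilon>)) \<le> p z"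
    by (rule seminorm_net_bound(2)[OF padd pscale pbdd _ Wscale _ _ _ _ zW z(2)];
        use net' \<epsilon> \<epsilon>0 s in \<open>force\<close>)
  have qz: "q z \<le> \<epsilon> * card S * (1 + \<epsilon>) / (1 - \<epsilon>)"
    by (rule seminorm_net_bound(1)[OF qadd qscale qbdd _ Wscale _ _ _ _ zW z(2), where a=0];
        use net' \<epsilon> \<epsilon>0 s in \<open>force\<close>)
  have e4: "(1 + \<epsilon>) * s * (1 + \<epsilon>) / (1 - \<epsilon>) \<le> (1 + 4 * \<epsilon>) * s"
    using mult_right_mono[OF r s(1)] by (simp add: mult_ac)
  have up: "p z \<le> (1 + 4 * \<epsilon>) * s" using pz1 e4 by linarith
  have lo: "(1 - 4 * \<epsilon>) * s \<le> p z"
  proof -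
    have "\<epsilon> * ((1 + \<epsilon>) * s * (1 + \<epsilon>) / (1 - \<epsilon>)) \<le> \<epsilon> * ((1 + 4 * \<epsilon>) * s)"
      using e4 \<epsilon>0 by (intro mult_left_mono) auto
    then have "((1 - \<epsilon>) * (1 - \<epsilon>) - \<epsilon> * (1 + 4 * \<epsilon>)) * s \<le> p z"
      using pz2 by (simp add: algebra_simps)
    moreover have "(1 - 4 * \<epsilon>) * s \<le> ((1 - \<epsilon>) * (1 - \<epsilon>) - \<epsilon> * (1 + 4 * \<epsilon>)) * s"
    proof (intro mult_right_mono s)
      have "\<epsilon> * (3 * \<epsilon>) \<le> \<epsilon> * 1" using \<epsilon> \<epsilon>0 by (intro mult_left_mono) auto
      then show "1 - 4 * \<epsilon> \<le> (1 - \<epsilon>) * (1 - \<epsilon>) - \<epsilon> * (1 + 4 * \<epsilon>)"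
        by (simp add: algebra_simps)
    qed
    ultimately show ?thesis by linarith
  qed
  \<comment> \<open>Squaring \<open>1 + 4 * \<epsilon>\<close> adds
    \<open>8 * \<epsilon> + 16 * \<epsilon>\<^sup>2\<close>, which is at most
    \<open>10 * \<epsilon>\<close>.\<close>
  have e2: "\<epsilon> * (16 * \<epsilon>) \<le> \<epsilon> * 2" using \<epsilon> \<epsilon>0 by (intro mult_left_mono) auto
  have "(p z)\<^sup>2 \<le> ((1 + 4 * \<epsilon>) * s)\<^sup>2" using up p0 by (intro power_mono)
  also have "\<dots> = (1 + 4 * \<epsilon>)\<^sup>2 * card S" by (simp add: power_mult_distrib s)
  also have "\<dots> \<le> (1 + 10 * \<epsilon>) * card S"
    using e2 by (intro mult_right_mono) (auto simp: power2_eq_square algebra_simps)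
  finally have 1: "(p z)\<^sup>2 \<le> (1 + 10 * \<epsilon>) * card S" .
  have "(1 - 10 * \<epsilon>) * card S \<le> (1 - 4 * \<epsilon>)\<^sup>2 * card S"
    using \<epsilon>0 by (intro mult_right_mono) (auto simp: power2_eq_square algebra_simps)
  also have "\<dots> = ((1 - 4 * \<epsilon>) * s)\<^sup>2" by (simp add: power_mult_distrib s)
  also have "\<dots> \<le> (p z)\<^sup>2" using lo s(1) \<epsilon> by (intro power_mono) auto
  finally have 2: "(1 - 10 * \<epsilon>) * card S \<le> (p z)\<^sup>2" .
  have "\<epsilon> * card S * ((1 + \<epsilon>) / (1 - \<epsilon>)) \<le> \<epsilon> * card S * 10"
    using \<epsilon> \<epsilon>0 by (intro mult_left_mono) (auto simp: field_simps)
  then have 3: "q z \<le> 10 * \<epsilon> * card S" using qz by simp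
  show ?thesis
    using 1 2 3 unfolding balanced_def p2 q_def[symmetric] abs_le_iff
    by (simp add: algebra_simps)
qed

section \<open>The maximizer of the quadratic form\<close>

definition low_idx :: "nat \<Rightarrow> (nat \<Rightarrow> real) \<Rightarrow> nat set" where
  "low_idx m X = {i \<in> {..<m}. (X i)\<^sup>2 \<le> (\<Sum>k<m. (X k)\<^sup>2) / m / 2}"

definition high_idx :: "nat \<Rightarrow> (nat \<Rightarrow> real) \<Rightarrow> nat set" where
  "high_idx m X = {i \<in> {..<m}. (X i)\<^sup>2 \<ge> (\<Sum>k<m. (X k)\<^sup>2) / m / 2}"

lemma low_high_idx_subset: "low_idx m X \<subseteq> {..<m}" "high_idx m X \<subseteq> {..<m}"
  by (auto simp: low_idx_def high_idx_def)

lemma finite_low_high_idx: "finite (low_idx m X)" "finite (high_idx m X)"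
  by (simp_all add: low_idx_def high_idx_def)

text \<open>The factor \<open>b\<^sup>2\<close> cancels from the threshold test, so the index sets
  depend on the direction of \<open>x\<close> only and the scale survives just in
  \<open>rhat\<close>. All probabilistic estimates can therefore be made for a unit vector.\<close>

lemma rhat_Iminus_Iplus_normalized:
  fixes m n :: nat and \<omega> :: "nat \<times> nat \<Rightarrow> real"
  assumes e: "\<And>j. x j = b * e j" and b: "b > 0"
  defines "X \<equiv> \<lambda>i. vinner n (avec \<omega> i) e"
  shows "rhat m n \<omega> x = b * sqrt ((\<Sum>i<m. (X i)\<^sup>2) / m)"
    and "Iminus m n \<omega> x = low_idx m X" and "Iplus m n \<omega> x = high_idx m X"
proof -
  have xe: "x = (\<lambda>j. b * e j)" using e by auto
  have psi: "(psi n \<omega> x i)\<^sup>2 = b\<^sup>2 * (X i)\<^sup>2" for i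
    by (simp add: psi_def X_def xe vinner_scale_right power_mult_distrib)
  have "rhat m n \<omega> x = sqrt (b\<^sup>2 * ((\<Sum>i<m. (X i)\<^sup>2) / m))"
    unfolding rhat_def psi by (simp flip: sum_distrib_left)
  then show r: "rhat m n \<omega> x = b * sqrt ((\<Sum>i<m. (X i)\<^sup>2) / m)"
    using b by (simp only: real_sqrt_mult real_sqrt_abs abs_of_pos)
  have "(rhat m n \<omega> x)\<^sup>2 / 2 = b\<^sup>2 * ((\<Sum>i<m. (X i)\<^sup>2) / m / 2)"
    unfolding r by (simp add: power_mult_distrib sum_nonneg)
  moreover have "b\<^sup>2 * s \<le> b\<^sup>2 * t \<longleftrightarrow> s \<le> t" for s t using b by simp
  ultimately show "Iminus m n \<omega> x = low_idx m X" "Iplus m n \<omega> x = high_idx m X"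
    unfolding Iminus_def Iplus_def low_idx_def high_idx_def psi by (simp_all only:)
qed

text \<open>The two averages of \<open>X\<^sup>2\<close> are separated by the definition of the index sets alone,
  so no truncated Gaussian moments are needed.\<close>

lemma low_idx_sum_le:
  "(\<Sum>i\<in>low_idx m X. (X i)\<^sup>2) \<le> (\<Sum>k<m. (X k)\<^sup>2) / m / 2 * card (low_idx m X)"
  using sum_bounded_above[of "low_idx m X" "\<lambda>i. (X i)\<^sup>2" "(\<Sum>k<m. (X k)\<^sup>2) / m / 2"]
  by (simp add: low_idx_def mult.commute)

text \<open>Every term outside the high set is below half the overall mean, and discarding terms
  below the mean cannot lower the average. This gives the full mean, twice what the threshold itself
  would give.\<close>

lemma high_idx_sum_ge:
  "(\<Sum>k<m. (X k)\<^sup>2) / m * card (high_idx m X) \<le> (\<Sum>i\<in>high_idx m X. (X i)\<^sup>2)"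
proof (cases "m = 0")
  case True
  then show ?thesis by (simp add: high_idx_def)
next
  case False
  define R where "R = (\<Sum>k<m. (X k)\<^sup>2) / m"
  have R: "R \<ge> 0" by (simp add: R_def sum_nonneg)
  let ?H = "high_idx m X" and ?C = "{..<m} - high_idx m X"
  have sub: "?H \<subseteq> {..<m}" by (auto simp: high_idx_def)
  have "(\<Sum>i\<in>?C. (X i)\<^sup>2) \<le> (\<Sum>i\<in>?C. R)"
  proof (rule sum_mono)
    fix i assume "i \<in> ?C"
    then have "(X i)\<^sup>2 < R / 2" by (auto simp: high_idx_def R_def)
    then show "(X i)\<^sup>2 \<le> R" using R by simp
  qed
  moreover have "(\<Sum>i\<in>?C. (X i)\<^sup>2) + (\<Sum>i\<in>?H. (X i)\<^sup>2) = R * m"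
    using sum.subset_diff[OF sub, of "\<lambda>i. (X i)\<^sup>2"] False by (simp add: R_def)
  moreover have "(\<Sum>i\<in>?C. R) + (\<Sum>i\<in>?H. R) = R * m"
    using sum.subset_diff[OF sub, of "\<lambda>i. R"] by (simp add: mult.commute)
  ultimately show ?thesis by (simp add: R_def[symmetric] mult.commute)
qed

text \<open>The form of \<open>quadY\<close> with index sets and vectors as free parameters, so that
  the argument about its maximizer is deterministic.\<close>

definition quad2 :: "real \<Rightarrow> real \<Rightarrow> nat \<Rightarrow> nat set \<Rightarrow> nat set \<Rightarrow> (nat \<Rightarrow> nat \<Rightarrow> real)
    \<Rightarrow> (nat \<Rightarrow> real) \<Rightarrow> real" where
  "quad2 lm lp n L H a z = lm / card L * (\<Sum>i\<in>L. (vinner n (a i) z)\<^sup>2)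
     + lp / card H * (\<Sum>i\<in>H. (vinner n (a i) z)\<^sup>2)"

text \<open>Writing \<open>d = \<alpha> e + \<beta> w\<close>, maximality gives
  \<open>\<beta>\<^sup>2 (Q e - Q w) \<le> 2 \<alpha> \<beta> B(e, w)\<close> with gap \<open>Q e - Q w \<ge> |lm| / 4\<close> and a small cross term.\<close>

lemma maximizer_perp_bound:
  fixes m n :: nat and a :: "nat \<Rightarrow> nat \<Rightarrow> real"
  assumes lmp: "lm < 0" "lp > 0" and \<epsilon>: "0 < \<epsilon>" "8 * \<epsilon> * (lp - lm) \<le> - lm"
    and e: "vnorm n e = 1" and d: "vnorm n d = 1"
  defines "X \<equiv> \<lambda>i. vinner n (a i) e"
  defines "L \<equiv> low_idx m X" and "H \<equiv> high_idx m X"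
  assumes ne: "L \<noteq> {}" "H \<noteq> {}"
    and R: "\<bar>(\<Sum>i<m. (X i)\<^sup>2) / m - 1\<bar> \<le> \<epsilon>"
    and iso: "\<And>z. vinner n e z = 0 \<Longrightarrow> vnorm n z = 1 \<Longrightarrow>
      balanced \<epsilon> L X (\<lambda>i. vinner n (a i) z) \<and> balanced \<epsilon> H X (\<lambda>i. vinner n (a i) z)"
    and max: "quad2 lm lp n L H a e \<le> quad2 lm lp n L H a d"
  shows "vnorm n (perp n e d) \<le> 8 * \<epsilon> * (lp - lm) / (- lm)"
proof (cases "vnorm n (perp n e d) = 0")
  case True
  moreover have "0 \<le> 8 * \<epsilon> * (lp - lm) / (- lm)"
    using lmp \<epsilon> by (intro divide_nonneg_pos mult_nonneg_nonneg) auto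
  ultimately show ?thesis by simp
next
  case False
  define \<beta> where "\<beta> = vnorm n (perp n e d)"
  define \<alpha> where "\<alpha> = vinner n d e"
  define w where "w = (\<lambda>j. (1 / \<beta>) * perp n e d j)"
  define R' where "R' = (\<Sum>i<m. (X i)\<^sup>2) / m"
  have \<beta>: "\<beta> > 0" using False vnorm_nonneg[of n "perp n e d"] by (simp add: \<beta>_def)
  have w1: "vnorm n w = 1" using \<beta> by (simp only: w_def vnorm_scale) (simp add: \<beta>_def[symmetric])
  have w0: "vinner n e w = 0" by (simp only: w_def vinner_scale_right vinner_perp[OF e])
  have \<alpha>\<beta>: "\<alpha>\<^sup>2 = 1 - \<beta>\<^sup>2"
    unfolding \<beta>_def vnorm_perp[OF e] by (simp add: \<alpha>_def d)
  have dw: "vinner n (a i) d = \<alpha> * X i + \<beta> * vinner n (a i) w" for i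
  proof -
    have "d = (\<lambda>j. \<alpha> * e j + \<beta> * w j)"
      using \<beta> by (auto simp: w_def perp_def \<alpha>_def)
    then have "vinner n (a i) d = vinner n (a i) (\<lambda>j. \<alpha> * e j + \<beta> * w j)" by simp
    then show ?thesis by (simp add: vinner_add_right vinner_scale_right X_def)
  qed
  have exp: "(\<Sum>i\<in>S. (vinner n (a i) d)\<^sup>2) = \<alpha>\<^sup>2 * (\<Sum>i\<in>S. (X i)\<^sup>2)
      + 2 * \<alpha> * \<beta> * (\<Sum>i\<in>S. X i * vinner n (a i) w) + \<beta>\<^sup>2 * (\<Sum>i\<in>S. (vinner n (a i) w)\<^sup>2)" for S
    unfolding dw power2_sum by (simp add: sum.distrib sum_distrib_left power_mult_distrib mult_ac)
  have cL: "real (card L) > 0" and cH: "real (card H) > 0"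
    using ne by (simp_all add: L_def H_def finite_low_high_idx card_gt_0_iff)
  define AL where "AL = (\<Sum>i\<in>L. (X i)\<^sup>2) / card L"
  define AH where "AH = (\<Sum>i\<in>H. (X i)\<^sup>2) / card H"
  define BL where "BL = (\<Sum>i\<in>L. X i * vinner n (a i) w) / card L"
  define BH where "BH = (\<Sum>i\<in>H. X i * vinner n (a i) w) / card H"
  define CL where "CL = (\<Sum>i\<in>L. (vinner n (a i) w)\<^sup>2) / card L"
  define CH where "CH = (\<Sum>i\<in>H. (vinner n (a i) w)\<^sup>2) / card H"
  have isoL: "balanced \<epsilon> L X (\<lambda>i. vinner n (a i) w)" and isoH: "balanced \<epsilon> H X (\<lambda>i. vinner n (a i) w)"
    using iso[OF w0 w1] by auto
  have AL: "AL \<le> R' / 2"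
    using low_idx_sum_le[of X m] cL by (simp add: AL_def R'_def L_def[symmetric] divide_simps)
  have AH: "R' \<le> AH"
    using high_idx_sum_ge[where X=X and m=m] cH
    by (simp add: AH_def R'_def H_def[symmetric] pos_le_divide_eq)
  have CL: "1 - \<epsilon> \<le> CL"
    using isoL unfolding CL_def pos_le_divide_eq[OF cL]
    by (simp add: balanced_def abs_le_iff algebra_simps)
  have CH: "CH \<le> 1 + \<epsilon>"
    using isoH unfolding CH_def pos_divide_le_eq[OF cH]
    by (simp add: balanced_def abs_le_iff algebra_simps)
  have BL: "\<bar>BL\<bar> \<le> \<epsilon>"
    using isoL unfolding BL_def abs_divide abs_of_nat pos_divide_le_eq[OF cL]
    by (simp add: balanced_def)
  have BH: "\<bar>BH\<bar> \<le> \<epsilon>"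
    using isoH unfolding BH_def abs_divide abs_of_nat pos_divide_le_eq[OF cH]
    by (simp add: balanced_def)
  define g where "g = lm * (AL - CL) + lp * (AH - CH)"
  define c where "c = lm * BL + lp * BH"
  have Re: "1 - \<epsilon> \<le> R'" "R' \<le> 1 + \<epsilon>" using R by (auto simp: R'_def)
  \<comment> \<open>The gap comes from the low set: \<open>AL\<close> is at most
    \<open>(1 + \<epsilon>) / 2\<close> and \<open>CL\<close> at least
    \<open>1 - \<epsilon>\<close>. From the high set it is enough that the difference is no worse
    than \<open>- 2 * \<epsilon>\<close>.\<close>
  have "g \<ge> (- lm) * (1/2 - 3/2 * \<epsilon>) + lp * (- 2 * \<epsilon>)"
  proof -
    have "(- lm) * (1/2 - 3/2 * \<epsilon>) \<le> (- lm) * (CL - AL)"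
      using lmp CL AL Re by (intro mult_left_mono) auto
    moreover have "lp * (- 2 * \<epsilon>) \<le> lp * (AH - CH)"
      using lmp CH AH Re by (intro mult_left_mono) auto
    ultimately show ?thesis by (simp add: g_def algebra_simps)
  qed
  moreover have "lm * \<epsilon> \<le> 0" using lmp \<epsilon> by (simp add: mult_nonpos_nonneg)
  ultimately have g: "g \<ge> - lm / 4" using \<epsilon>(2) by (simp add: algebra_simps)
  have "\<bar>c\<bar> \<le> \<bar>lm\<bar> * \<bar>BL\<bar> + \<bar>lp\<bar> * \<bar>BH\<bar>"
    unfolding c_def abs_mult[symmetric] by (rule abs_triangle_ineq)
  also have "\<dots> \<le> \<bar>lm\<bar> * \<epsilon> + \<bar>lp\<bar> * \<epsilon>"
    using BL BH by (intro add_mono mult_left_mono) auto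
  finally have c: "\<bar>c\<bar> \<le> \<epsilon> * (lp - lm)" using lmp by (simp add: algebra_simps)
  have Qe: "quad2 lm lp n L H a e = lm * AL + lp * AH"
    by (simp add: quad2_def AL_def AH_def X_def)
  have "quad2 lm lp n L H a d = lm * (\<alpha>\<^sup>2 * AL + 2 * \<alpha> * \<beta> * BL + \<beta>\<^sup>2 * CL)
      + lp * (\<alpha>\<^sup>2 * AH + 2 * \<alpha> * \<beta> * BH + \<beta>\<^sup>2 * CH)"
    unfolding quad2_def exp AL_def AH_def BL_def BH_def CL_def CH_def
    by (simp add: add_divide_distrib algebra_simps)
  then have "\<beta>\<^sup>2 * g \<le> 2 * \<alpha> * \<beta> * c"
    using max unfolding Qe \<alpha>\<beta> g_def c_def by (simp add: algebra_simps)
  \<comment> \<open>The cross term carries a factor \<beta> as well. Cancelling it leaves a bound on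
    \<beta> that is linear in \<epsilon>.\<close>
  then have "\<beta> * (\<beta> * g) \<le> \<beta> * (2 * \<alpha> * c)" by (simp add: power2_eq_square algebra_simps)
  then have "\<beta> * g \<le> 2 * \<alpha> * c" using \<beta> by (simp only: mult_le_cancel_left_pos)
  also have "\<dots> \<le> \<bar>2 * \<alpha> * c\<bar>" by simp
  also have "\<dots> = 2 * (\<bar>\<alpha>\<bar> * \<bar>c\<bar>)" by (simp add: abs_mult)
  also have "\<dots> \<le> 2 * (1 * (\<epsilon> * (lp - lm)))"
  proof -
    have "\<alpha>\<^sup>2 \<le> 1\<^sup>2" using \<alpha>\<beta> by simp
    then have "\<bar>\<alpha>\<bar> \<le> 1" by (simp add: abs_square_le_1)
    then have "\<bar>\<alpha>\<bar> * \<bar>c\<bar> \<le> 1 * (\<epsilon> * (lp - lm))" using c by (intro mult_mono) simp_all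
    then show ?thesis by simp
  qed
  finally have "\<beta> * g \<le> 2 * \<epsilon> * (lp - lm)" by simp
  moreover have "\<beta> * (- lm / 4) \<le> \<beta> * g" using g \<beta> by (intro mult_left_mono) auto
  ultimately have "\<beta> * (- lm) \<le> 8 * \<epsilon> * (lp - lm)" by linarith
  then show ?thesis using lmp unfolding \<beta>_def[symmetric] by (simp only: pos_le_divide_eq neg_0_less_iff_less)
qed

text \<open>Relative to \<open>b\<close>, the error orthogonal to \<open>e\<close> is
  \<open>r * \<beta>\<close>, and the error along \<open>e\<close> is at most
  \<open>\<bar>r - 1\<bar> + r * (1 - \<bar>\<alpha>\<bar>)\<close>, where
  \<open>1 - \<bar>\<alpha>\<bar> \<le> \<beta>\<^sup>2 \<le> \<beta>\<close>. The factor 4 is made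
  of two terms \<open>r * \<beta>\<close> with \<open>r \<le> 2\<close>.\<close>

lemma pdist_scaled_direction:
  assumes e: "vnorm n e = 1" and d: "vnorm n d = 1" and r: "0 \<le> r" "\<bar>r\<^sup>2 - 1\<bar> \<le> \<epsilon>" "\<epsilon> \<le> 1"
    and x: "\<And>j. x j = b * e j" and b: "b > 0"
  shows "pdist n (\<lambda>j. b * r * d j) x \<le> (\<epsilon> + 4 * vnorm n (perp n e d)) * b"
proof -
  define \<beta> where "\<beta> = vnorm n (perp n e d)"
  define \<alpha> where "\<alpha> = vinner n d e"
  have \<beta>0: "0 \<le> \<beta>" by (simp add: \<beta>_def vnorm_nonneg)
  have \<alpha>\<beta>: "\<alpha>\<^sup>2 = 1 - \<beta>\<^sup>2"
    unfolding \<beta>_def vnorm_perp[OF e] by (simp add: \<alpha>_def d)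
  have "\<beta>\<^sup>2 \<le> 1\<^sup>2" using \<alpha>\<beta> zero_le_power2[of \<alpha>] by simp
  then have \<beta>1: "\<beta> \<le> 1" by (rule power2_le_imp_le) simp
  have "\<alpha>\<^sup>2 \<le> 1\<^sup>2" using \<alpha>\<beta> by simp
  then have \<alpha>1: "\<bar>\<alpha>\<bar> \<le> 1" by (simp add: abs_square_le_1)
  have "(1 - \<bar>\<alpha>\<bar>) * 1 \<le> (1 - \<bar>\<alpha>\<bar>) * (1 + \<bar>\<alpha>\<bar>)"
    using \<alpha>1 by (intro mult_left_mono) auto
  also have "\<dots> = 1 - \<bar>\<alpha>\<bar>\<^sup>2" by (simp add: algebra_simps power2_eq_square)
  also have "\<dots> = \<beta>\<^sup>2" using \<alpha>\<beta> by simp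
  also have "\<beta>\<^sup>2 \<le> \<beta>" using \<beta>0 \<beta>1 by (simp add: power2_eq_square mult_left_le)
  finally have \<alpha>: "1 - \<bar>\<alpha>\<bar> \<le> \<beta>" by simp
  have "\<bar>r - 1\<bar> * 1 \<le> \<bar>r - 1\<bar> * (r + 1)" using r by (intro mult_left_mono) auto
  also have "\<dots> = \<bar>(r - 1) * (r + 1)\<bar>" using r(1) by (simp add: abs_mult)
  also have "(r - 1) * (r + 1) = r\<^sup>2 - 1" by (simp add: algebra_simps power2_eq_square)
  finally have r1: "\<bar>r - 1\<bar> \<le> \<epsilon>" using r by simp
  \<comment> \<open>\<open>s\<close> is the sign opposite to \<alpha>: the value -1 compares with
    \<open>x\<close>, the value 1 with the reflected vector. The minimum in \<open>pdist\<close>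
    permits either choice.\<close>
  have key: "vnorm n (\<lambda>j. b * r * d j + s * x j) \<le> (\<epsilon> + 4 * \<beta>) * b"
    if s: "\<bar>s\<bar> = 1" "s * \<alpha> = - \<bar>\<alpha>\<bar>" for s
  proof -
    have "(\<lambda>j. b * r * d j + s * x j) = (\<lambda>j. (b * r) * perp n e d j + (b * (r * \<alpha> + s)) * e j)"
      by (auto simp: perp_def \<alpha>_def x algebra_simps)
    then have "vnorm n (\<lambda>j. b * r * d j + s * x j) \<le> b * r * \<beta> + b * \<bar>r * \<alpha> + s\<bar>"
      using vnorm_triangle[of n "\<lambda>j. (b * r) * perp n e d j" "\<lambda>j. (b * (r * \<alpha> + s)) * e j"] b r e
      by (simp add: vnorm_scale abs_mult \<beta>_def)
    also have "\<bar>r * \<alpha> + s\<bar> = \<bar>s * (r * \<alpha> + s)\<bar>" using s by (simp add: abs_mult)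
    also have "s * (r * \<alpha> + s) = (1 - r) + r * (1 - \<bar>\<alpha>\<bar>)"
    proof -
      have "s * s = 1" using s(1) by (metis abs_mult_self_eq mult_1)
      then have "s * (r * \<alpha> + s) = r * (s * \<alpha>) + 1" by (simp add: algebra_simps)
      then show ?thesis unfolding s(2) by (simp add: algebra_simps)
    qed
    also have "\<bar>(1 - r) + r * (1 - \<bar>\<alpha>\<bar>)\<bar> \<le> \<bar>1 - r\<bar> + \<bar>r * (1 - \<bar>\<alpha>\<bar>)\<bar>" by (rule abs_triangle_ineq)
    also have "\<dots> = \<bar>r - 1\<bar> + r * (1 - \<bar>\<alpha>\<bar>)" using r \<alpha>1 by (simp add: abs_mult)
    also have "\<dots> \<le> \<epsilon> + r * \<beta>" using r1 r \<alpha> by (intro add_mono mult_left_mono) auto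
    finally have "vnorm n (\<lambda>j. b * r * d j + s * x j) \<le> b * r * \<beta> + b * (\<epsilon> + r * \<beta>)"
      using b by simp
    also have "\<dots> = (\<epsilon> + 2 * (r * \<beta>)) * b" by (simp add: algebra_simps)
    also have "\<dots> \<le> (\<epsilon> + 2 * (2 * \<beta>)) * b"
      using r1 r \<beta>0 b by (intro mult_right_mono add_left_mono mult_left_mono) auto
    finally show ?thesis by simp
  qed
  show ?thesis
  proof (cases "\<alpha> \<ge> 0")
    case True
    then show ?thesis using key[of "-1"] by (simp add: pdist_def \<beta>_def)
  next
    case False
    then show ?thesis using key[of 1] by (simp add: pdist_def \<beta>_def)
  qed
qed

section \<open>Joint laws from characteristic functions\<close>

text \<open>The probability measure with density \<open>(2 + h) / (2 + E h)\<close> gives \<open>X\<close> the characteristic function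
  of \<open>N\<close>, so Levy's uniqueness theorem in dimension one applies; this avoids a multivariate version.\<close>

lemma (in prob_space) integral_indicator_of_char_real:
  fixes h :: "'a \<Rightarrow> real"
  assumes X [measurable]: "X \<in> borel_measurable M"
    and h [measurable]: "h \<in> borel_measurable M" and bound: "\<And>\<omega>. \<bar>h \<omega>\<bar> \<le> 1"
    and N: "real_distribution N"
    and charX: "\<And>u. (CLINT \<omega>|M. iexp (u * X \<omega>)) = char N u"
    and fact: "\<And>u. (CLINT \<omega>|M. h \<omega> * iexp (u * X \<omega>)) = expectation h * char N u"
    and B: "B \<in> sets borel"
  shows "(LINT \<omega>|M. h \<omega> * indicator B (X \<omega>)) = expectation h * measure N B"
proof -
  define I where "I = expectation h"
  have inth: "integrable M h"
    by (rule integrable_const_bound[where B=1]) (use bound in auto)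
  have "\<bar>I\<bar> \<le> (LINT \<omega>|M. \<bar>h \<omega>\<bar>)" unfolding I_def by (rule integral_abs_bound)
  also have "\<dots> \<le> (LINT \<omega>|M. 1)"
    by (rule integral_mono) (use inth bound in auto)
  finally have I: "\<bar>I\<bar> \<le> 1" by (simp add: prob_space)
  \<comment> \<open>As \<open>h\<close> and its mean are bounded by 1, the shift by 2 keeps
    numerator and denominator at least 1.\<close>
  define g where "g = (\<lambda>\<omega>. (2 + h \<omega>) / (2 + I))"
  have g [measurable]: "g \<in> borel_measurable M" unfolding g_def by measurable
  have g0: "g \<omega> \<ge> 0" for \<omega>
    using bound[of \<omega>] I by (auto simp: g_def intro!: divide_nonneg_pos)
  have intg: "integrable M g" unfolding g_def using inth by auto
  have "(LINT \<omega>|M. g \<omega>) = 1"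
    using inth I by (simp add: g_def prob_space I_def[symmetric])
  define D where "D = density M (\<lambda>\<omega>. ennreal (g \<omega>))"
  have XD [measurable]: "X \<in> borel_measurable D" by (simp add: D_def)
  interpret D: prob_space D
  proof
    have "emeasure D (space D) = ennreal (LINT \<omega>|M. g \<omega>)"
      unfolding D_def by (simp add: emeasure_density nn_integral_eq_integral intg g0 cong: nn_integral_cong)
    then show "emeasure D (space D) = 1" using \<open>(LINT \<omega>|M. g \<omega>) = 1\<close> by simp
  qed
  have intc: "integrable M (\<lambda>\<omega>. iexp (u * X \<omega>))" for u
    by (rule integrable_const_bound[where B=1]) auto
  have inthc: "integrable M (\<lambda>\<omega>. h \<omega> * iexp (u * X \<omega>))" for u
    by (rule integrable_const_bound[where B=1]) (use bound in \<open>auto simp: norm_mult\<close>)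
  have "char (distr D borel X) u = char N u" for u
  proof -
    have "char (distr D borel X) u = (CLINT \<omega>|D. iexp (u * X \<omega>))"
      unfolding char_def by (rule integral_distr) auto
    also have "\<dots> = (CLINT \<omega>|M. g \<omega> *\<^sub>R iexp (u * X \<omega>))"
      unfolding D_def by (rule integral_density) (use g0 in auto)
    also have "\<dots> = (CLINT \<omega>|M. (2 * iexp (u * X \<omega>) + h \<omega> * iexp (u * X \<omega>)) / (2 + I))"
      by (intro Bochner_Integration.integral_cong) (auto simp: g_def scaleR_conv_of_real field_simps)
    also have "\<dots> = (2 * char N u + I * char N u) / (2 + I)"
      using intc inthc charX fact by (simp add: I_def)
    also have "\<dots> = char N u"
    proof -
      have "complex_of_real (2 + I) \<noteq> 0" using I by (simp only: of_real_eq_0_iff)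
      then have "2 + complex_of_real I \<noteq> 0" by simp
      then show ?thesis by (simp add: field_simps)
    qed
    finally show ?thesis .
  qed
  then have "distr D borel X = N"
    by (intro Levy_uniqueness N D.real_distribution_distr) auto
  then have "measure N B = measure (distr D borel X) B" by simp
  also have "\<dots> = (LINT \<omega>|distr D borel X. indicator B \<omega>)" using B by simp
  also have "\<dots> = (LINT \<omega>|D. indicator B (X \<omega>))"
    by (rule integral_distr) (use B in auto)
  also have "\<dots> = (LINT \<omega>|M. g \<omega> *\<^sub>R indicator B (X \<omega>))"
    unfolding D_def using B g0 by (intro integral_density) auto
  also have "\<dots> = (LINT \<omega>|M. (2 * indicator B (X \<omega>) + h \<omega> * indicator B (X \<omega>)) / (2 + I))"
    by (intro Bochner_Integration.integral_cong) (auto simp: g_def field_simps)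
  finally have 1: "measure N B = (LINT \<omega>|M. (2 * indicator B (X \<omega>) + h \<omega> * indicator B (X \<omega>)) / (2 + I))" .
  have intB: "integrable M (\<lambda>\<omega>. indicator B (X \<omega>) :: real)"
    by (rule integrable_const_bound[where B=1]) (use B in auto)
  have inthB: "integrable M (\<lambda>\<omega>. h \<omega> * indicator B (X \<omega>))"
    by (rule integrable_const_bound[where B=1])
       (use B bound in \<open>auto simp: abs_mult indicator_def\<close>)
  have "measure N B = (LINT \<omega>|M. indicator B (X \<omega>))"
  proof -
    have "distr M borel X = N"
    proof (intro Levy_uniqueness N real_distribution_distr X ext)
      fix u show "char (distr M borel X) u = char N u"
        unfolding char_def[of "distr M borel X"] charX[symmetric] by (rule integral_distr) auto
    qed
    then have "measure N B = (LINT \<omega>|distr M borel X. indicator B \<omega>)" using B by auto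
    also have "\<dots> = (LINT \<omega>|M. indicator B (X \<omega>))"
      by (rule integral_distr) (use B in auto)
    finally show ?thesis .
  qed
  \<comment> \<open>\<open>X\<close> has law \<open>N\<close> both under \<open>M\<close> and under
    the density. Equating the two values at \<open>B\<close> leaves a linear equation for the wanted
    integral.\<close>
  then have "measure N B = (2 * measure N B + (LINT \<omega>|M. h \<omega> * indicator B (X \<omega>))) / (2 + I)"
    using 1 intB inthB by simp
  then show ?thesis using I by (simp add: I_def[symmetric] field_simps)
qed

text \<open>A density has to be real, so the complex weight is split into real and imaginary parts.
  The factorization passes to the conjugate weight, since conjugation exchanges the frequencies
  \<open>u\<close> and \<open>- u\<close>.\<close>

lemma (in prob_space) integral_indicator_of_char:
  fixes h :: "'a \<Rightarrow> complex"
  assumes X [measurable]: "X \<in> borel_measurable M"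
    and h [measurable]: "h \<in> borel_measurable M" and bound: "\<And>\<omega>. norm (h \<omega>) \<le> 1"
    and N: "real_distribution N"
    and charX: "\<And>u. (CLINT \<omega>|M. iexp (u * X \<omega>)) = char N u"
    and fact: "\<And>u. (CLINT \<omega>|M. h \<omega> * iexp (u * X \<omega>)) = (CLINT \<omega>|M. h \<omega>) * char N u"
    and B: "B \<in> sets borel"
  shows "(CLINT \<omega>|M. h \<omega> * indicator B (X \<omega>)) = (CLINT \<omega>|M. h \<omega>) * measure N B"
proof -
  have inth: "integrable M h"
    by (rule integrable_const_bound[where B=1]) (use bound in auto)
  have inthc: "integrable M (\<lambda>\<omega>. h \<omega> * iexp (u * X \<omega>))" for u
    by (rule integrable_const_bound[where B=1]) (use bound in \<open>auto simp: norm_mult\<close>)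
  have [measurable]: "(\<lambda>\<omega>. cnj (h \<omega>)) \<in> borel_measurable M"
    by (intro borel_measurable_continuous_on[where f=cnj] continuous_intros h)
  have inthc': "integrable M (\<lambda>\<omega>. cnj (h \<omega>) * iexp (u * X \<omega>))" for u
    by (rule integrable_const_bound[where B=1]) (use bound in \<open>auto simp: norm_mult\<close>)
  have cnjh: "(CLINT \<omega>|M. cnj (h \<omega>) * iexp (u * X \<omega>)) = cnj (CLINT \<omega>|M. h \<omega>) * char N u" for u
  proof -
    have "(CLINT \<omega>|M. cnj (h \<omega>) * iexp (u * X \<omega>)) = (CLINT \<omega>|M. cnj (h \<omega> * iexp ((-u) * X \<omega>)))"
      by (intro Bochner_Integration.integral_cong) (auto simp: exp_cnj)
    also have "\<dots> = cnj (CLINT \<omega>|M. h \<omega> * iexp ((-u) * X \<omega>))" by (rule Bochner_Integration.integral_cnj)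
    also have "\<dots> = cnj (CLINT \<omega>|M. h \<omega>) * cnj (CLINT \<omega>|M. iexp ((-u) * X \<omega>))"
      unfolding fact charX by simp
    also have "cnj (CLINT \<omega>|M. iexp ((-u) * X \<omega>)) = (CLINT \<omega>|M. cnj (iexp ((-u) * X \<omega>)))"
      by (rule Bochner_Integration.integral_cnj[symmetric])
    also have "\<dots> = (CLINT \<omega>|M. iexp (u * X \<omega>))"
      by (intro Bochner_Integration.integral_cong) (auto simp: exp_cnj)
    finally show ?thesis unfolding charX .
  qed
  have Re: "(LINT \<omega>|M. Re (h \<omega>) * indicator B (X \<omega>)) = (LINT \<omega>|M. Re (h \<omega>)) * measure N B"
  proof (rule integral_indicator_of_char_real[OF X _ _ N charX _ B])
    show "\<bar>Re (h \<omega>)\<bar> \<le> 1" for \<omega> using abs_Re_le_cmod[of "h \<omega>"] bound[of \<omega>] by linarith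
    fix u
    have "(CLINT \<omega>|M. complex_of_real (Re (h \<omega>)) * iexp (u * X \<omega>))
        = (CLINT \<omega>|M. (h \<omega> * iexp (u * X \<omega>) + cnj (h \<omega>) * iexp (u * X \<omega>)) / 2)"
      by (intro Bochner_Integration.integral_cong refl)
         (simp add: complex_add_cnj flip: distrib_right)
    also have "\<dots> = ((CLINT \<omega>|M. h \<omega>) * char N u + cnj (CLINT \<omega>|M. h \<omega>) * char N u) / 2"
      by (simp only: integral_divide_zero Bochner_Integration.integral_add[OF inthc inthc'] fact cnjh)
    also have "\<dots> = complex_of_real (Re (CLINT \<omega>|M. h \<omega>)) * char N u"
      by (simp add: complex_add_cnj flip: distrib_right)
    finally show "(CLINT \<omega>|M. complex_of_real (Re (h \<omega>)) * iexp (u * X \<omega>))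
        = complex_of_real (LINT \<omega>|M. Re (h \<omega>)) * char N u"
      using inth by simp
  qed auto
  have Im: "(LINT \<omega>|M. Im (h \<omega>) * indicator B (X \<omega>)) = (LINT \<omega>|M. Im (h \<omega>)) * measure N B"
  proof (rule integral_indicator_of_char_real[OF X _ _ N charX _ B])
    show "\<bar>Im (h \<omega>)\<bar> \<le> 1" for \<omega> using abs_Im_le_cmod[of "h \<omega>"] bound[of \<omega>] by linarith
    fix u
    have *: "complex_of_real (Im w) * z = (w * z - cnj w * z) / (2 * \<i>)" for w z
    proof -
      have "w * z - cnj w * z = (2 * \<i>) * (complex_of_real (Im w) * z)"
        by (simp add: complex_diff_cnj flip: left_diff_distrib)
      moreover have "2 * \<i> \<noteq> 0" by simp
      ultimately show ?thesis by (simp only: nonzero_mult_div_cancel_left not_False_eq_True)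
    qed
    have "(CLINT \<omega>|M. complex_of_real (Im (h \<omega>)) * iexp (u * X \<omega>))
        = (CLINT \<omega>|M. (h \<omega> * iexp (u * X \<omega>) - cnj (h \<omega>) * iexp (u * X \<omega>)) / (2 * \<i>))"
      by (simp only: *)
    also have "\<dots> = ((CLINT \<omega>|M. h \<omega>) * char N u - cnj (CLINT \<omega>|M. h \<omega>) * char N u) / (2 * \<i>)"
      by (simp only: integral_divide_zero Bochner_Integration.integral_diff[OF inthc inthc'] fact cnjh)
    also have "\<dots> = complex_of_real (Im (CLINT \<omega>|M. h \<omega>)) * char N u"
      by (simp only: *)
    finally show "(CLINT \<omega>|M. complex_of_real (Im (h \<omega>)) * iexp (u * X \<omega>))
        = complex_of_real (LINT \<omega>|M. Im (h \<omega>)) * char N u"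
      using inth by simp
  qed auto
  have inthB: "integrable M (\<lambda>\<omega>. h \<omega> * indicator B (X \<omega>))"
    by (rule integrable_const_bound[where B=1])
       (use B bound in \<open>auto simp: norm_mult indicator_def\<close>)
  have "Re (CLINT \<omega>|M. h \<omega> * indicator B (X \<omega>)) = (LINT \<omega>|M. Re (h \<omega>) * indicator B (X \<omega>))"
    using inthB by (subst integral_Re[symmetric]) (auto intro!: Bochner_Integration.integral_cong simp: indicator_def)
  moreover have "Im (CLINT \<omega>|M. h \<omega> * indicator B (X \<omega>)) = (LINT \<omega>|M. Im (h \<omega>) * indicator B (X \<omega>))"
    using inthB by (subst integral_Im[symmetric]) (auto intro!: Bochner_Integration.integral_cong simp: indicator_def)
  ultimately show ?thesis
    using inth Re Im by (simp add: complex_eq_iff)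
qed

text \<open>The exponentials in the joint characteristic function are traded for indicators one
  coordinate at a time, each trade being one-dimensional. Once all are traded, the identity gives
  the probabilities of boxes, which determine the product measure.\<close>

theorem (in prob_space) distr_PiM_of_char:
  fixes X :: "'i \<Rightarrow> 'a \<Rightarrow> real" and N :: "'i \<Rightarrow> real measure"
  assumes K: "finite K"
    and X: "\<And>k. k \<in> K \<Longrightarrow> X k \<in> borel_measurable M"
    and N: "\<And>k. real_distribution (N k)"
    and char: "\<And>u. (CLINT \<omega>|M. (\<Prod>k\<in>K. iexp (u k * X k \<omega>))) = (\<Prod>k\<in>K. char (N k) (u k))"
  shows "distr M (PiM K N) (\<lambda>\<omega>. \<lambda>k\<in>K. X k \<omega>) = PiM K N"
proof -
  have N_sets [simp, measurable_cong]: "sets (N k) = sets borel" for k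
    using N by (simp add: real_distribution.events_eq_borel)
  have N_prob: "prob_space (N k)" for k using N by (simp add: real_distribution_def)
  interpret P: product_prob_space N K
    by (intro product_prob_spaceI N_prob)
  have char1: "(CLINT \<omega>|M. iexp (t * X k \<omega>)) = char (N k) t" if k: "k \<in> K" for k t
  proof -
    have "(\<Prod>l\<in>K. iexp ((if l = k then t else 0) * X l \<omega>)) = iexp (t * X k \<omega>)" for \<omega>
      using K k by (subst prod.remove[OF K k]) (auto intro!: prod.neutral)
    moreover have "(\<Prod>l\<in>K. char (N l) (if l = k then t else 0)) = char (N k) t"
      using K k N by (subst prod.remove[OF K k]) (auto intro!: prod.neutral simp: real_distribution.char_zero)
    ultimately show ?thesis using char[of "\<lambda>l. if l = k then t else 0"] by simp
  qed
  \<comment> \<open>\<open>J\<close> contains the coordinates already traded. The frequencies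
    \<open>u\<close> stay arbitrary in the induction, because the next trade needs the identity at
    every frequency of its own coordinate.\<close>
  have box: "(CLINT \<omega>|M. (\<Prod>k\<in>J. indicator (A k) (X k \<omega>)) * (\<Prod>k\<in>K - J. iexp (u k * X k \<omega>)))
      = (\<Prod>k\<in>J. measure (N k) (A k)) * (\<Prod>k\<in>K - J. char (N k) (u k))"
    if A: "\<And>k. k \<in> K \<Longrightarrow> A k \<in> sets borel" and J: "J \<subseteq> K" for A J u
  proof -
    have "finite J" using J K finite_subset by blast
    then show ?thesis using J
    proof (induction J arbitrary: u)
      case empty
      then show ?case using char by simp
    next
      case (insert k J)
      have k: "k \<in> K" "k \<notin> J" and JK: "J \<subseteq> K" using insert by auto
      define L where "L = K - insert k J"
      have KL: "K - J = insert k L" "k \<notin> L" "finite L" using k K by (auto simp: L_def)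
      have meas [measurable]: "X l \<in> borel_measurable M" if "l \<in> insert k (L \<union> J)" for l
        using X JK k that by (auto simp: L_def)
      \<comment> \<open>The factors of all coordinates other than \<open>k\<close> form the bounded
        weight for the one-dimensional lemma.\<close>
      define h where "h = (\<lambda>\<omega>. (\<Prod>l\<in>J. indicator (A l) (X l \<omega>)) * (\<Prod>l\<in>L. iexp (u l * X l \<omega>)))"
      have AJ [measurable]: "A l \<in> sets borel" if "l \<in> insert k J" for l using A JK k that by auto
      have hm [measurable]: "h \<in> borel_measurable M"
        unfolding h_def by (intro borel_measurable_times borel_measurable_prod) measurable
      have hn: "norm (h \<omega>) \<le> 1" for \<omega>
      proof -
        have "norm (h \<omega>) = (\<Prod>l\<in>J. indicator (A l) (X l \<omega>)) * 1"
          unfolding h_def norm_mult prod_norm[symmetric]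
          by (intro arg_cong2[where f="(*)"] prod.cong prod.neutral) (auto simp: indicator_def)
        also have "\<dots> \<le> 1" by (auto intro!: prod_le_1 simp: indicator_def)
        finally show ?thesis .
      qed
      define c where "c = (\<Prod>l\<in>J. complex_of_real (measure (N l) (A l))) * (\<Prod>l\<in>L. char (N l) (u l))"
      have hc: "(CLINT \<omega>|M. h \<omega> * iexp (t * X k \<omega>)) = c * char (N k) t" for t
      proof -
        have *: "(\<Prod>l\<in>L. f l ((u(k := t)) l)) = (\<Prod>l\<in>L. f l (u l))" for f :: "'i \<Rightarrow> real \<Rightarrow> complex"
          using KL by (intro prod.cong) auto
        show ?thesis
          using insert.IH[OF JK, of "u(k := t)"] KL(2,3)
            *[of "\<lambda>l. char (N l)"] *[of "\<lambda>l t. iexp (t * X l _)"]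
          unfolding KL(1) by (simp add: h_def c_def mult_ac)
      qed
      have h0: "(CLINT \<omega>|M. h \<omega>) = c"
        using hc[of 0] N by (simp add: real_distribution.char_zero)
      have "(CLINT \<omega>|M. h \<omega> * indicator (A k) (X k \<omega>)) = (CLINT \<omega>|M. h \<omega>) * measure (N k) (A k)"
        by (rule integral_indicator_of_char[OF _ hm hn N char1[OF k(1)]]) (use hc h0 in auto)
      then show ?case
        using insert.hyps unfolding h0 L_def[symmetric] by (simp add: h_def c_def mult_ac)
    qed
  qed
  show ?thesis
  proof (rule P.PiM_eqI[OF K])
    show "sets (distr M (PiM K N) (\<lambda>\<omega>. \<lambda>k\<in>K. X k \<omega>)) = sets (PiM K N)" by simp
  next
    fix A assume "\<And>i. i \<in> K \<Longrightarrow> A i \<in> sets (N i)"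
    then have A [measurable]: "\<And>i. i \<in> K \<Longrightarrow> A i \<in> sets borel" by simp
    have XK: "(\<lambda>\<omega>. \<lambda>k\<in>K. X k \<omega>) \<in> measurable M (PiM K N)"
      by (rule measurable_restrict) (use X in auto)
    have "emeasure (distr M (PiM K N) (\<lambda>\<omega>. \<lambda>k\<in>K. X k \<omega>)) (PiE K A)
        = emeasure M ((\<lambda>\<omega>. \<lambda>k\<in>K. X k \<omega>) -` PiE K A \<inter> space M)"
      by (rule emeasure_distr[OF XK]) (use K A in \<open>auto intro!: sets_PiM_I_finite\<close>)
    also have "\<dots> = ennreal (prob ((\<lambda>\<omega>. \<lambda>k\<in>K. X k \<omega>) -` PiE K A \<inter> space M))"
      by (rule emeasure_eq_measure)
    also have "prob ((\<lambda>\<omega>. \<lambda>k\<in>K. X k \<omega>) -` PiE K A \<inter> space M) = (\<Prod>k\<in>K. measure (N k) (A k))"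
    proof -
      have S: "(\<lambda>\<omega>. \<lambda>k\<in>K. X k \<omega>) -` PiE K A \<inter> space M \<in> sets M"
        by (rule measurable_sets[OF XK]) (use K A in \<open>auto intro!: sets_PiM_I_finite\<close>)
      have "complex_of_real (prob ((\<lambda>\<omega>. \<lambda>k\<in>K. X k \<omega>) -` PiE K A \<inter> space M))
          = (CLINT \<omega>|M. of_real (indicator ((\<lambda>\<omega>. \<lambda>k\<in>K. X k \<omega>) -` PiE K A \<inter> space M) \<omega>))"
        using S by (subst integral_complex_of_real) auto
      also have "\<dots> = (CLINT \<omega>|M. (\<Prod>k\<in>K. indicator (A k) (X k \<omega>)))"
      proof (intro Bochner_Integration.integral_cong refl)
        fix \<omega> assume "\<omega> \<in> space M"
        then show "of_real (indicator ((\<lambda>\<omega>. \<lambda>k\<in>K. X k \<omega>) -` PiE K A \<inter> space M) \<omega>)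
            = (\<Prod>k\<in>K. indicator (A k) (X k \<omega>) :: complex)"
          using K by (auto simp: indicator_def PiE_def Pi_def prod_zero_iff)
      qed
      also have "\<dots> = (\<Prod>k\<in>K. complex_of_real (measure (N k) (A k)))"
        using box[of A K "\<lambda>_. 0"] A by simp
      finally show ?thesis unfolding of_real_prod[symmetric] of_real_eq_iff .
    qed
    also have "ennreal (\<Prod>k\<in>K. measure (N k) (A k)) = (\<Prod>k\<in>K. emeasure (N k) (A k))"
      by (simp add: prod_ennreal finite_measure.emeasure_eq_measure prob_space.finite_measure N_prob)
    finally show "emeasure (distr M (PiM K N) (\<lambda>\<omega>. \<lambda>k\<in>K. X k \<omega>)) (PiE K A) = (\<Prod>k\<in>K. emeasure (N k) (A k))" .
  qed
qed

section \<open>Gaussian concentration\<close>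

lemma real_distribution_std_gauss: "real_distribution std_gauss"
  unfolding std_gauss_def by (rule real_dist_normal_dist)

lemma prob_space_std_gauss: "prob_space std_gauss"
  using real_distribution_std_gauss by (simp add: real_distribution_def)

lemma sets_std_gauss [simp, measurable_cong]: "sets std_gauss = sets borel"
  by (simp add: std_gauss_def)

lemma space_std_gauss [simp]: "space std_gauss = UNIV"
  by (simp add: std_gauss_def)

interpretation std_gauss: prob_space std_gauss
  by (rule prob_space_std_gauss)

interpretation gauss_PiM: product_sigma_finite "\<lambda>_. std_gauss"
  by (simp add: product_sigma_finite_def std_gauss.sigma_finite_measure_axioms)

lemma prod_char_std_gauss:
  assumes "finite K"
  shows "(\<Prod>k\<in>K. char std_gauss (u k)) = complex_of_real (exp (- (\<Sum>k\<in>K. (u k)\<^sup>2) / 2))"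
proof -
  have "(\<Prod>k\<in>K. char std_gauss (u k)) = complex_of_real (\<Prod>k\<in>K. exp (- (u k)\<^sup>2 / 2))"
    unfolding std_gauss_def char_std_normal_distribution by (simp only: of_real_prod)
  also have "(\<Prod>k\<in>K. exp (- (u k)\<^sup>2 / 2)) = exp (\<Sum>k\<in>K. - (u k)\<^sup>2 / 2)"
    using assms by (rule exp_sum[symmetric])
  also have "(\<Sum>k\<in>K. - (u k)\<^sup>2 / 2) = - (\<Sum>k\<in>K. (u k)\<^sup>2) / 2"
    by (simp only: sum_divide_distrib[symmetric] sum_negf)
  finally show ?thesis .
qed

text \<open>The joint characteristic function of the forms at \<open>u\<close> is that of the
  coordinates at \<open>v\<close>, the combination of the rows with weights \<open>u\<close>. A
  Gaussian one depends only on the sum of squares, and orthonormality makes those of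
  \<open>u\<close> and \<open>v\<close> equal.\<close>

lemma distr_orthonormal_gauss:
  fixes c :: "'k \<Rightarrow> 't \<Rightarrow> real"
  assumes T: "finite T" and K: "finite K"
    and orth: "\<And>k l. k \<in> K \<Longrightarrow> l \<in> K \<Longrightarrow> (\<Sum>t\<in>T. c k t * c l t) = (if k = l then 1 else 0)"
  shows "distr (PiM T (\<lambda>_. std_gauss)) (PiM K (\<lambda>_. std_gauss)) (\<lambda>\<omega>. \<lambda>k\<in>K. \<Sum>t\<in>T. c k t * \<omega> t)
      = PiM K (\<lambda>_. std_gauss)"
proof -
  interpret P: prob_space "PiM T (\<lambda>_. std_gauss)"
    by (intro prob_space_PiM prob_space_std_gauss)
  show ?thesis
  proof (rule P.distr_PiM_of_char[OF K _ real_distribution_std_gauss])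
    show "(\<lambda>\<omega>. \<Sum>t\<in>T. c k t * \<omega> t) \<in> borel_measurable (PiM T (\<lambda>_. std_gauss))" for k
      by measurable
  next
    fix u :: "'k \<Rightarrow> real"
    define v where "v t = (\<Sum>k\<in>K. u k * c k t)" for t
    have "(\<Sum>t\<in>T. (v t)\<^sup>2) = (\<Sum>t\<in>T. \<Sum>k\<in>K. \<Sum>l\<in>K. u k * u l * (c k t * c l t))"
      by (simp add: v_def power2_eq_square sum_product mult_ac)
    also have "\<dots> = (\<Sum>k\<in>K. \<Sum>t\<in>T. \<Sum>l\<in>K. u k * u l * (c k t * c l t))"
      by (rule sum.swap)
    also have "\<dots> = (\<Sum>k\<in>K. \<Sum>l\<in>K. \<Sum>t\<in>T. u k * u l * (c k t * c l t))"
      by (intro sum.cong refl sum.swap)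
    also have "\<dots> = (\<Sum>k\<in>K. \<Sum>l\<in>K. u k * u l * (if k = l then 1 else 0))"
      by (intro sum.cong refl) (simp add: orth flip: sum_distrib_left)
    also have "\<dots> = (\<Sum>k\<in>K. (u k)\<^sup>2)"
      using K by (intro sum.cong refl) (simp add: power2_eq_square if_distrib cong: if_cong)
    finally have sq: "(\<Sum>t\<in>T. (v t)\<^sup>2) = (\<Sum>k\<in>K. (u k)\<^sup>2)" .
    have "(\<Prod>k\<in>K. iexp (u k * (\<Sum>t\<in>T. c k t * \<omega> t))) = (\<Prod>t\<in>T. iexp (v t * \<omega> t))" for \<omega>
    proof -
      have "(\<Sum>k\<in>K. u k * (\<Sum>t\<in>T. c k t * \<omega> t)) = (\<Sum>t\<in>T. v t * \<omega> t)"
        unfolding v_def sum_distrib_left sum_distrib_right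
        by (subst sum.swap) (simp add: mult_ac)
      then show ?thesis
        using T K by (simp flip: exp_sum sum_distrib_left of_real_sum of_real_mult)
    qed
    then have "(CLINT \<omega>|PiM T (\<lambda>_. std_gauss). (\<Prod>k\<in>K. iexp (u k * (\<Sum>t\<in>T. c k t * \<omega> t))))
        = (CLINT \<omega>|PiM T (\<lambda>_. std_gauss). (\<Prod>t\<in>T. iexp (v t * \<omega> t)))" by simp
    also have "\<dots> = (\<Prod>t\<in>T. CLINT y|std_gauss. iexp (v t * y))"
      by (rule gauss_PiM.product_integral_prod[OF T], rule std_gauss.integrable_const_bound[where B=1]) auto
    also have "\<dots> = (\<Prod>t\<in>T. char std_gauss (v t))" by (simp add: char_def)
    also have "\<dots> = (\<Prod>k\<in>K. char std_gauss (u k))"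
      using sq unfolding prod_char_std_gauss[OF T] prod_char_std_gauss[OF K] by simp
    finally show "(CLINT \<omega>|PiM T (\<lambda>_. std_gauss). (\<Prod>k\<in>K. iexp (u k * (\<Sum>t\<in>T. c k t * \<omega> t))))
        = (\<Prod>k\<in>K. char std_gauss (u k))" .
  qed
qed

section \<open>Exponential moments and tail bounds\<close>

lemma nn_integral_normal_density:
  assumes "\<sigma> > 0"
  shows "(\<integral>\<^sup>+y. ennreal (normal_density \<mu> \<sigma> y) \<partial>lborel) = 1"
  using assms by (subst nn_integral_eq_integral) auto

lemma nn_integral_std_gauss_exp_linear:
  "(\<integral>\<^sup>+y. ennreal (exp (t * y)) \<partial>std_gauss) = ennreal (exp (t\<^sup>2 / 2))"
proof -
  have "(\<integral>\<^sup>+y. ennreal (exp (t * y)) \<partial>std_gauss)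
      = (\<integral>\<^sup>+y. ennreal (std_normal_density y) * ennreal (exp (t * y)) \<partial>lborel)"
    unfolding std_gauss_def by (rule nn_integral_density) auto
  also have "\<dots> = (\<integral>\<^sup>+y. ennreal (exp (t\<^sup>2 / 2)) * ennreal (normal_density t 1 y) \<partial>lborel)"
  proof (intro nn_integral_cong)
    fix y :: real
    have "std_normal_density y * exp (t * y) = exp (t\<^sup>2 / 2) * normal_density t 1 y"
      by (simp add: normal_density_def field_simps power2_eq_square flip: exp_add)
    then show "ennreal (std_normal_density y) * ennreal (exp (t * y))
        = ennreal (exp (t\<^sup>2 / 2)) * ennreal (normal_density t 1 y)"
      by (simp flip: ennreal_mult')
  qed
  also have "\<dots> = ennreal (exp (t\<^sup>2 / 2))"
    by (simp add: nn_integral_cmult nn_integral_normal_density)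
  finally show ?thesis .
qed

text \<open>The weight \<open>exp (t * y\<^sup>2)\<close> turns the standard density into
  \<open>s\<close> times the centred normal density with variance
  \<open>s\<^sup>2 = 1 / (1 - 2 * t)\<close>.\<close>

lemma nn_integral_std_gauss_exp_square:
  assumes "t < 1/2"
  shows "(\<integral>\<^sup>+y. ennreal (exp (t * y\<^sup>2)) \<partial>std_gauss) = ennreal (1 / sqrt (1 - 2 * t))"
proof -
  define s where "s = 1 / sqrt (1 - 2 * t)"
  have s: "s > 0" "s\<^sup>2 = 1 / (1 - 2 * t)" using assms by (simp_all add: s_def power_divide)
  have "(\<integral>\<^sup>+y. ennreal (exp (t * y\<^sup>2)) \<partial>std_gauss)
      = (\<integral>\<^sup>+y. ennreal (std_normal_density y) * ennreal (exp (t * y\<^sup>2)) \<partial>lborel)"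
    unfolding std_gauss_def by (rule nn_integral_density) auto
  also have "\<dots> = (\<integral>\<^sup>+y. ennreal s * ennreal (normal_density 0 s y) \<partial>lborel)"
  proof (intro nn_integral_cong)
    fix y :: real
    have "- y\<^sup>2 / 2 + t * y\<^sup>2 = - y\<^sup>2 / (2 * s\<^sup>2)"
      using assms unfolding s(2) by (simp add: field_simps)
    then have "exp (- y\<^sup>2 / 2) * exp (t * y\<^sup>2) = exp (- y\<^sup>2 / (2 * s\<^sup>2))"
      by (simp only: flip: exp_add)
    moreover have "sqrt (2 * pi * s\<^sup>2) = sqrt (2 * pi) * s"
      unfolding real_sqrt_mult[of "2 * pi"] using s(1) by simp
    ultimately have "std_normal_density y * exp (t * y\<^sup>2) = s * normal_density 0 s y"
      using s by (simp add: normal_density_def)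
    then show "ennreal (std_normal_density y) * ennreal (exp (t * y\<^sup>2))
        = ennreal s * ennreal (normal_density 0 s y)"
      using s by (simp flip: ennreal_mult')
  qed
  also have "\<dots> = ennreal s"
    using s by (simp add: nn_integral_cmult nn_integral_normal_density)
  finally show ?thesis by (simp add: s_def)
qed

text \<open>The logarithm of the moment is \<open>- ln (1 - 2 * t) / 2\<close>, and
  \<open>ln (1 + y) \<ge> y - 2 * y\<^sup>2\<close> is applied at \<open>y = - 2 * t\<close>. That
  estimate needs an argument of size at most 1/2, hence the range of \<open>t\<close>.\<close>

lemma nn_integral_std_gauss_exp_square_le:
  assumes "\<bar>t\<bar> \<le> 1/4"
  shows "(\<integral>\<^sup>+y. ennreal (exp (t * y\<^sup>2)) \<partial>std_gauss) \<le> ennreal (exp (t + 4 * t\<^sup>2))"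
proof -
  have pos: "1 - 2 * t > 0" using assms by auto
  have "\<bar>ln (1 + (- 2 * t)) - (- 2 * t)\<bar> \<le> 2 * (- 2 * t)\<^sup>2"
    by (rule abs_ln_one_plus_x_minus_x_bound) (use assms in auto)
  then have "- 2 * t - 8 * t\<^sup>2 \<le> ln (1 - 2 * t)"
    by (simp add: power_mult_distrib abs_le_iff)
  then have "exp (- 2 * (t + 4 * t\<^sup>2)) \<le> 1 - 2 * t"
    using pos by (simp add: ln_ge_iff)
  then have "sqrt ((exp (- (t + 4 * t\<^sup>2)))\<^sup>2) \<le> sqrt (1 - 2 * t)"
    by (intro real_sqrt_le_mono) (simp flip: exp_double)
  then have "exp (- (t + 4 * t\<^sup>2)) \<le> sqrt (1 - 2 * t)" by simp
  then have "1 / sqrt (1 - 2 * t) \<le> 1 / exp (- (t + 4 * t\<^sup>2))"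
    using pos by (intro divide_left_mono) auto
  then have "1 / sqrt (1 - 2 * t) \<le> exp (t + 4 * t\<^sup>2)"
    by (simp add: exp_minus[symmetric] inverse_eq_divide[symmetric] add.commute)
  then show ?thesis
    using assms by (subst nn_integral_std_gauss_exp_square) (auto intro: ennreal_leI)
qed

text \<open>Exponential Markov inequality: the indicator is at most the exponential of the sum minus
  \<open>u\<close>, whose integral factors over the coordinates. Squares, linear forms and counts
  all arise from suitable \<open>f\<close>; nonnegative integrals avoid integrability
  conditions.\<close>

lemma gauss_PiM_chernoff:
  fixes f :: "'j \<Rightarrow> real \<Rightarrow> real"
  assumes J: "finite J" and f: "\<And>j. j \<in> J \<Longrightarrow> f j \<in> borel_measurable borel"
    and g: "\<And>j. j \<in> J \<Longrightarrow> (\<integral>\<^sup>+y. ennreal (exp (f j y)) \<partial>std_gauss) \<le> ennreal (exp (g j))"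
  shows "emeasure (PiM J (\<lambda>_. std_gauss)) {y \<in> space (PiM J (\<lambda>_. std_gauss)). u \<le> (\<Sum>j\<in>J. f j (y j))}
      \<le> ennreal (exp ((\<Sum>j\<in>J. g j) - u))"
proof -
  let ?P = "PiM J (\<lambda>_. std_gauss)"
  let ?S = "{y \<in> space ?P. u \<le> (\<Sum>j\<in>J. f j (y j))}"
  have [measurable]: "(\<lambda>y. f j (y j)) \<in> borel_measurable ?P" if "j \<in> J" for j
    using that f by measurable
  have "emeasure ?P ?S = (\<integral>\<^sup>+y. indicator ?S y \<partial>?P)"
    by (rule nn_integral_indicator[symmetric]) measurable
  also have "\<dots> \<le> (\<integral>\<^sup>+y. ennreal (exp (- u)) * (\<Prod>j\<in>J. ennreal (exp (f j (y j)))) \<partial>?P)"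
  proof (intro nn_integral_mono)
    fix y
    have "ennreal (exp (- u)) * (\<Prod>j\<in>J. ennreal (exp (f j (y j)))) = ennreal (exp ((\<Sum>j\<in>J. f j (y j)) - u))"
      using J by (simp add: prod_ennreal exp_diff exp_minus field_simps prod_nonneg exp_sum flip: ennreal_mult')
    then show "indicator ?S y \<le> ennreal (exp (- u)) * (\<Prod>j\<in>J. ennreal (exp (f j (y j))))"
      by (auto simp: indicator_def ennreal_1[symmetric] simp del: ennreal_1 intro!: ennreal_leI)
  qed
  also have "\<dots> = ennreal (exp (- u)) * (\<integral>\<^sup>+y. (\<Prod>j\<in>J. ennreal (exp (f j (y j)))) \<partial>?P)"
    by (rule nn_integral_cmult) measurable
  also have "(\<integral>\<^sup>+y. (\<Prod>j\<in>J. ennreal (exp (f j (y j)))) \<partial>?P)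
      = (\<Prod>j\<in>J. \<integral>\<^sup>+y. ennreal (exp (f j y)) \<partial>std_gauss)"
    by (rule gauss_PiM.product_nn_integral_prod[OF J]) (use f in measurable)
  also have "\<dots> \<le> (\<Prod>j\<in>J. ennreal (exp (g j)))"
    by (intro prod_mono_ennreal g)
  also have "ennreal (exp (- u)) * (\<Prod>j\<in>J. ennreal (exp (g j))) = ennreal (exp ((\<Sum>j\<in>J. g j) - u))"
    using J by (simp add: prod_ennreal exp_diff exp_minus field_simps prod_nonneg exp_sum flip: ennreal_mult')
  finally show ?thesis by (simp add: mult_left_mono)
qed

text \<open>The sign of \<open>t\<close> is free, so both tails are covered. Coordinates outside
  \<open>S\<close> get the exponent 0 and contribute a factor 1.\<close>

lemma gauss_PiM_square_tail:
  assumes J: "finite J" and S: "S \<subseteq> J" and t: "\<bar>t\<bar> \<le> 1/4"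
  shows "emeasure (PiM J (\<lambda>_. std_gauss))
      {y \<in> space (PiM J (\<lambda>_. std_gauss)). u \<le> t * (\<Sum>j\<in>S. (y j)\<^sup>2)}
      \<le> ennreal (exp ((t + 4 * t\<^sup>2) * card S - u))"
proof -
  have JS: "{j \<in> J. j \<in> S} = S" using S by auto
  define f where "f j y = (if j \<in> S then t * y\<^sup>2 else 0)" for j and y :: real
  define g where "g j = (if j \<in> S then t + 4 * t\<^sup>2 else 0)" for j
  have "emeasure (PiM J (\<lambda>_. std_gauss)) {y \<in> space (PiM J (\<lambda>_. std_gauss)). u \<le> (\<Sum>j\<in>J. f j (y j))}
      \<le> ennreal (exp ((\<Sum>j\<in>J. g j) - u))"
  proof (rule gauss_PiM_chernoff[OF J])
    fix j
    show "f j \<in> borel_measurable borel"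
      by (cases "j \<in> S") (simp_all add: f_def cong: measurable_cong)
    show "(\<integral>\<^sup>+y. ennreal (exp (f j y)) \<partial>std_gauss) \<le> ennreal (exp (g j))"
      using nn_integral_std_gauss_exp_square_le[OF t] std_gauss.emeasure_space_1
      by (cases "j \<in> S") (simp_all add: f_def g_def)
  qed
  moreover have "(\<Sum>j\<in>J. f j (y j)) = t * (\<Sum>j\<in>S. (y j)\<^sup>2)" for y
    using J by (simp add: f_def JS sum_distrib_left flip: sum.inter_filter)
  moreover have "(\<Sum>j\<in>J. g j) = (t + 4 * t\<^sup>2) * card S"
    using J by (simp add: g_def JS flip: sum.inter_filter)
  ultimately show ?thesis by simp
qed

lemma gauss_PiM_linear_tail:
  assumes J: "finite J" and S: "S \<subseteq> J"
  shows "emeasure (PiM J (\<lambda>_. std_gauss))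
      {y \<in> space (PiM J (\<lambda>_. std_gauss)). u \<le> t * (\<Sum>j\<in>S. x j * y j)}
      \<le> ennreal (exp (t\<^sup>2 / 2 * (\<Sum>j\<in>S. (x j)\<^sup>2) - u))"
proof -
  have JS: "{j \<in> J. j \<in> S} = S" using S by auto
  define f where "f j y = (if j \<in> S then (t * x j) * y else 0)" for j and y :: real
  define g where "g j = (if j \<in> S then (t * x j)\<^sup>2 / 2 else 0)" for j
  have "emeasure (PiM J (\<lambda>_. std_gauss)) {y \<in> space (PiM J (\<lambda>_. std_gauss)). u \<le> (\<Sum>j\<in>J. f j (y j))}
      \<le> ennreal (exp ((\<Sum>j\<in>J. g j) - u))"
  proof (rule gauss_PiM_chernoff[OF J])
    fix j
    show "f j \<in> borel_measurable borel"
      by (cases "j \<in> S") (simp_all add: f_def cong: measurable_cong)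
    show "(\<integral>\<^sup>+y. ennreal (exp (f j y)) \<partial>std_gauss) \<le> ennreal (exp (g j))"
      using nn_integral_std_gauss_exp_linear[of "t * x j"] std_gauss.emeasure_space_1
      by (cases "j \<in> S") (simp_all add: f_def g_def)
  qed
  moreover have "(\<Sum>j\<in>J. f j (y j)) = t * (\<Sum>j\<in>S. x j * y j)" for y
    using J by (simp add: f_def JS sum_distrib_left mult.assoc flip: sum.inter_filter)
  moreover have "(\<Sum>j\<in>J. g j) = t\<^sup>2 / 2 * (\<Sum>j\<in>S. (x j)\<^sup>2)"
    using J by (simp add: g_def JS power_mult_distrib sum_distrib_left flip: sum.inter_filter)
  ultimately show ?thesis by simp
qed

lemma emeasure_le_two_sets:
  assumes "A \<subseteq> B \<union> C" "B \<in> sets M" "C \<in> sets M"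
    and "emeasure M B \<le> ennreal b" "emeasure M C \<le> ennreal c" "0 \<le> b" "0 \<le> c"
  shows "emeasure M A \<le> ennreal (b + c)"
proof -
  have "emeasure M A \<le> emeasure M (B \<union> C)" using assms by (intro emeasure_mono) auto
  also have "\<dots> \<le> emeasure M B + emeasure M C" using assms by (intro emeasure_subadditive) auto
  also have "\<dots> \<le> ennreal b + ennreal c" using assms by (intro add_mono)
  finally show ?thesis using assms by simp
qed

text \<open>Per element of \<open>S\<close> the exponent is
  \<open>4 * t\<^sup>2 - t * \<epsilon>\<close> for the upper tail. Its minimum, at
  \<open>t = \<epsilon> / 8\<close>, is \<open>- \<epsilon>\<^sup>2 / 16\<close>; the lower tail is
  the same with \<open>- t\<close>.\<close>

lemma gauss_PiM_square_concentration:
  fixes \<epsilon> :: real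
  assumes J: "finite J" and S: "S \<subseteq> J" and \<epsilon>: "0 < \<epsilon>" "\<epsilon> \<le> 1"
  shows "emeasure (PiM J (\<lambda>_. std_gauss))
      {y \<in> space (PiM J (\<lambda>_. std_gauss)). \<epsilon> * card S < \<bar>(\<Sum>j\<in>S. (y j)\<^sup>2) - card S\<bar>}
      \<le> ennreal (2 * exp (- (\<epsilon>\<^sup>2 / 16) * card S))"
proof -
  let ?P = "PiM J (\<lambda>_. std_gauss)" and ?s = "real (card S)"
  have [measurable]: "(\<lambda>y. \<Sum>j\<in>S. (y j)\<^sup>2) \<in> borel_measurable ?P"
    using S by (intro borel_measurable_sum borel_measurable_power) (auto intro: measurable_component_singleton)
  define B where "B t u = {y \<in> space ?P. u \<le> t * (\<Sum>j\<in>S. (y j)\<^sup>2)}" for t u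
  have B [measurable]: "B t u \<in> sets ?P" for t u unfolding B_def by measurable
  have 1: "emeasure ?P (B (\<epsilon> / 8) (\<epsilon> / 8 * (1 + \<epsilon>) * ?s)) \<le> ennreal (exp (- (\<epsilon>\<^sup>2 / 16) * ?s))"
    unfolding B_def
    by (rule order_trans[OF gauss_PiM_square_tail[OF J S]])
       (use \<epsilon> in \<open>auto intro!: ennreal_leI simp: power2_eq_square field_simps\<close>)
  have 2: "emeasure ?P (B (- (\<epsilon> / 8)) (- (\<epsilon> / 8) * (1 - \<epsilon>) * ?s)) \<le> ennreal (exp (- (\<epsilon>\<^sup>2 / 16) * ?s))"
    unfolding B_def
    by (rule order_trans[OF gauss_PiM_square_tail[OF J S]])
       (use \<epsilon> in \<open>auto intro!: ennreal_leI simp: power2_eq_square field_simps\<close>)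
  have "emeasure ?P {y \<in> space ?P. \<epsilon> * ?s < \<bar>(\<Sum>j\<in>S. (y j)\<^sup>2) - ?s\<bar>}
      \<le> ennreal (exp (- (\<epsilon>\<^sup>2 / 16) * ?s) + exp (- (\<epsilon>\<^sup>2 / 16) * ?s))"
  proof (rule emeasure_le_two_sets[OF _ B B 1 2])
    show "{y \<in> space ?P. \<epsilon> * ?s < \<bar>(\<Sum>j\<in>S. (y j)\<^sup>2) - ?s\<bar>}
      \<subseteq> B (\<epsilon> / 8) (\<epsilon> / 8 * (1 + \<epsilon>) * ?s) \<union> B (- (\<epsilon> / 8)) (- (\<epsilon> / 8) * (1 - \<epsilon>) * ?s)"
    proof
      fix y assume "y \<in> {y \<in> space ?P. \<epsilon> * ?s < \<bar>(\<Sum>j\<in>S. (y j)\<^sup>2) - ?s\<bar>}"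
      then have y: "y \<in> space ?P" "(1 + \<epsilon>) * ?s \<le> (\<Sum>j\<in>S. (y j)\<^sup>2) \<or> (\<Sum>j\<in>S. (y j)\<^sup>2) \<le> (1 - \<epsilon>) * ?s"
        by (auto simp: algebra_simps abs_if split: if_splits)
      have e: "0 \<le> \<epsilon> / 8" using \<epsilon> by simp
      show "y \<in> B (\<epsilon> / 8) (\<epsilon> / 8 * (1 + \<epsilon>) * ?s) \<union> B (- (\<epsilon> / 8)) (- (\<epsilon> / 8) * (1 - \<epsilon>) * ?s)"
        using y(2)
      proof
        assume "(1 + \<epsilon>) * ?s \<le> (\<Sum>j\<in>S. (y j)\<^sup>2)"
        from mult_left_mono[OF this e] show ?thesis using y by (simp add: B_def mult.assoc)
      next
        assume "(\<Sum>j\<in>S. (y j)\<^sup>2) \<le> (1 - \<epsilon>) * ?s"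
        from mult_left_mono[OF this e] show ?thesis using y by (simp add: B_def mult.assoc)
      qed
    qed
  qed auto
  then show ?thesis by simp
qed

text \<open>Given the variance bound \<open>V\<close>, the exponent
  \<open>t\<^sup>2 * V / 2 - t * b\<close> is smallest at \<open>t = b / V\<close>.\<close>

lemma gauss_PiM_linear_concentration:
  fixes b V :: real
  assumes J: "finite J" and S: "S \<subseteq> J" and b: "0 < b" and V: "0 < V" "(\<Sum>j\<in>S. (x j)\<^sup>2) \<le> V"
  shows "emeasure (PiM J (\<lambda>_. std_gauss))
      {y \<in> space (PiM J (\<lambda>_. std_gauss)). b < \<bar>\<Sum>j\<in>S. x j * y j\<bar>}
      \<le> ennreal (2 * exp (- (b\<^sup>2 / (2 * V))))"
proof -
  let ?P = "PiM J (\<lambda>_. std_gauss)"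
  have [measurable]: "(\<lambda>y. \<Sum>j\<in>S. x j * y j) \<in> borel_measurable ?P"
    using S by (intro borel_measurable_sum borel_measurable_times) (auto intro: measurable_component_singleton)
  define B where "B t = {y \<in> space ?P. b\<^sup>2 / V \<le> t * (\<Sum>j\<in>S. x j * y j)}" for t
  have B [measurable]: "B t \<in> sets ?P" for t unfolding B_def by measurable
  have bd: "emeasure ?P (B t) \<le> ennreal (exp (- (b\<^sup>2 / (2 * V))))" if "t\<^sup>2 = (b / V)\<^sup>2" for t
    unfolding B_def
  proof (rule order_trans[OF gauss_PiM_linear_tail[OF J S]], intro ennreal_leI)
    have "t\<^sup>2 / 2 * (\<Sum>j\<in>S. (x j)\<^sup>2) \<le> t\<^sup>2 / 2 * V" using V by (intro mult_left_mono) auto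
    also have "\<dots> - b\<^sup>2 / V = - (b\<^sup>2 / (2 * V))"
      unfolding that using V by (simp add: power2_eq_square field_simps)
    finally show "exp (t\<^sup>2 / 2 * (\<Sum>j\<in>S. (x j)\<^sup>2) - b\<^sup>2 / V) \<le> exp (- (b\<^sup>2 / (2 * V)))" by simp
  qed
  have "emeasure ?P {y \<in> space ?P. b < \<bar>\<Sum>j\<in>S. x j * y j\<bar>}
      \<le> ennreal (exp (- (b\<^sup>2 / (2 * V))) + exp (- (b\<^sup>2 / (2 * V))))"
  proof (rule emeasure_le_two_sets[OF _ B B bd bd])
    show "{y \<in> space ?P. b < \<bar>\<Sum>j\<in>S. x j * y j\<bar>} \<subseteq> B (b / V) \<union> B (- (b / V))"
    proof
      fix y assume "y \<in> {y \<in> space ?P. b < \<bar>\<Sum>j\<in>S. x j * y j\<bar>}"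
      then have y: "y \<in> space ?P" "b \<le> (\<Sum>j\<in>S. x j * y j) \<or> b \<le> - (\<Sum>j\<in>S. x j * y j)" by auto
      have e: "0 \<le> b / V" using b V by simp
      show "y \<in> B (b / V) \<union> B (- (b / V))" using y(2)
      proof
        assume "b \<le> (\<Sum>j\<in>S. x j * y j)"
        from mult_left_mono[OF this e] show ?thesis using y by (simp add: B_def power2_eq_square)
      next
        assume "b \<le> - (\<Sum>j\<in>S. x j * y j)"
        from mult_left_mono[OF this e] show ?thesis using y by (simp add: B_def power2_eq_square)
      qed
    qed
  qed auto
  then show ?thesis by simp
qed

text \<open>On the nonnegative half-line the density decreases, so it is at least its value at
  \<open>b\<close> throughout the interval.\<close>

lemma emeasure_std_gauss_interval_pos:
  assumes "0 \<le> a" "a < b"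
  shows "0 < emeasure std_gauss {a..b}"
proof -
  have "0 < ennreal (std_normal_density b) * ennreal (b - a)"
    using assms by (simp add: ennreal_zero_less_mult_iff normal_density_pos)
  also have "\<dots> = (\<integral>\<^sup>+y. ennreal (std_normal_density b) * indicator {a..b} y \<partial>lborel)"
    using assms by (subst nn_integral_cmult_indicator) auto
  also have "\<dots> \<le> (\<integral>\<^sup>+y. ennreal (std_normal_density y) * indicator {a..b} y \<partial>lborel)"
    using assms
    by (intro nn_integral_mono)
       (auto simp: indicator_def normal_density_def intro!: ennreal_leI divide_right_mono power_mono)
  also have "\<dots> = emeasure std_gauss {a..b}"
    unfolding std_gauss_def by (subst emeasure_density) auto
  finally show ?thesis .
qed

text \<open>Lower tail of a binomial count. The mean of \<open>exp (- indicator A y)\<close> is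
  \<open>1 - 2 * \<kappa> \<le> exp (- 2 * \<kappa>)\<close>; half of this exponent pays for the
  threshold and half remains as the rate. \<kappa> depends on \<open>A\<close> alone.\<close>

lemma gauss_PiM_count_lower:
  assumes A: "A \<in> sets borel" "0 < emeasure std_gauss A"
  shows "\<exists>\<kappa>::real. 0 < \<kappa> \<and> (\<forall>J::'j set. finite J \<longrightarrow>
    emeasure (PiM J (\<lambda>_. std_gauss))
      {y \<in> space (PiM J (\<lambda>_. std_gauss)). real (card {j \<in> J. y j \<in> A}) < \<kappa> * card J}
      \<le> ennreal (exp (- \<kappa> * card J)))"
proof -
  define p where "p = measure std_gauss A"
  have p: "0 < p" "p \<le> 1"
    using A by (auto simp: p_def std_gauss.emeasure_eq_measure)
  define \<kappa> where "\<kappa> = p * (1 - exp (- 1)) / 2"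
  have k: "\<kappa> > 0" using p by (simp add: \<kappa>_def)
  have I: "(\<integral>\<^sup>+y. ennreal (exp (- indicator A y)) \<partial>std_gauss) \<le> ennreal (exp (- 2 * \<kappa>))"
  proof -
    have "(\<integral>\<^sup>+y. ennreal (exp (- indicator A y)) \<partial>std_gauss)
        = ennreal (LINT y|std_gauss. exp (- indicator A y))"
      by (rule nn_integral_eq_integral, rule std_gauss.integrable_const_bound[where B=1])
         (use A in \<open>auto simp: indicator_def\<close>)
    also have "(LINT y|std_gauss. exp (- indicator A y))
        = (LINT y|std_gauss. 1 - (1 - exp (- 1)) * indicator A y)"
      by (intro Bochner_Integration.integral_cong) (auto simp: indicator_def)
    also have "\<dots> = 1 - 2 * \<kappa>"
      using A by (subst Bochner_Integration.integral_diff)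
        (auto simp: std_gauss.prob_space[simplified] \<kappa>_def p_def std_gauss.emeasure_eq_measure)
    also have "1 - 2 * \<kappa> \<le> exp (- 2 * \<kappa>)" using exp_ge_add_one_self[of "- 2 * \<kappa>"] by simp
    finally show ?thesis by (simp add: ennreal_leI)
  qed
  have "emeasure (PiM J (\<lambda>_. std_gauss))
      {y \<in> space (PiM J (\<lambda>_. std_gauss)). card {j \<in> J. y j \<in> A} < \<kappa> * card J}
      \<le> ennreal (exp (- \<kappa> * card J))" if J: "finite J" for J :: "'j set"
  proof -
    let ?P = "PiM J (\<lambda>_. std_gauss)"
    have cnt: "(\<Sum>j\<in>J. - indicator A (y j)) = - real (card {j \<in> J. y j \<in> A})" for y
      using J by (simp add: sum_negf indicator_def Collect_conj_eq flip: sum.inter_filter)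
    have "emeasure ?P {y \<in> space ?P. card {j \<in> J. y j \<in> A} < \<kappa> * card J}
        \<le> emeasure ?P {y \<in> space ?P. - \<kappa> * card J \<le> (\<Sum>j\<in>J. - indicator A (y j))}"
    proof (rule emeasure_mono)
      have [measurable]: "(\<lambda>y. indicator A (y j) :: real) \<in> borel_measurable ?P" if "j \<in> J" for j
        using that A by measurable
      show "{y \<in> space ?P. - \<kappa> * card J \<le> (\<Sum>j\<in>J. - indicator A (y j))} \<in> sets ?P"
        by measurable
    qed (auto simp: cnt)
    also have "\<dots> \<le> ennreal (exp ((\<Sum>j\<in>J. - 2 * \<kappa>) - (- \<kappa> * card J)))"
      using A I by (intro gauss_PiM_chernoff[OF J]) auto
    also have "(\<Sum>j\<in>J. - 2 * \<kappa>) - (- \<kappa> * card J) = - \<kappa> * card J" by (simp add: algebra_simps)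
    finally show ?thesis .
  qed
  then show ?thesis
    using k by (intro exI[where x=\<kappa>]) simp
qed

section \<open>Concentration over the index sets\<close>

lemma prob_space_gauss_sample: "prob_space (gauss_sample m n)"
  unfolding gauss_sample_def by (intro prob_space_PiM prob_space_std_gauss)

lemma measurable_vinner_avec [measurable]:
  "i < m \<Longrightarrow> (\<lambda>\<omega>. vinner n (avec \<omega> i) w) \<in> borel_measurable (gauss_sample m n)"
  unfolding vinner_def avec_def gauss_sample_def by measurable

text \<open>Forms taken in different rows involve disjoint coordinates and are orthogonal for that
  reason, so orthonormality is asked for only within a row.\<close>

lemma distr_vinner_gauss_sample:
  fixes F :: "'k \<Rightarrow> nat \<Rightarrow> real" and r :: "'k \<Rightarrow> nat"
  assumes K: "finite K" and r: "\<And>k. k \<in> K \<Longrightarrow> r k < m"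
    and orth: "\<And>k l. k \<in> K \<Longrightarrow> l \<in> K \<Longrightarrow> r k = r l \<Longrightarrow> vinner n (F k) (F l) = (if k = l then 1 else 0)"
  shows "distr (gauss_sample m n) (PiM K (\<lambda>_. std_gauss)) (\<lambda>\<omega>. \<lambda>k\<in>K. vinner n (avec \<omega> (r k)) (F k))
      = PiM K (\<lambda>_. std_gauss)"
proof -
  define c where "c k t = (if r k = fst t then F k (snd t) else 0)" for k and t :: "nat \<times> nat"
  let ?T = "{..<m} \<times> {..<n}"
  have "(\<Sum>t\<in>?T. c k t * c l t) = (if k = l then 1 else 0)" if kl: "k \<in> K" "l \<in> K" for k l
  proof -
    have "(\<Sum>t\<in>?T. c k t * c l t) = (\<Sum>i<m. \<Sum>j<n. c k (i, j) * c l (i, j))"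
      by (simp add: sum.cartesian_product)
    also have "\<dots> = (\<Sum>i<m. if r k = i then (if r k = r l then vinner n (F k) (F l) else 0) else 0)"
      by (intro sum.cong refl) (auto simp: c_def vinner_def)
    also have "\<dots> = (if r k = r l then vinner n (F k) (F l) else 0)"
      using r[OF kl(1)] by simp
    also have "\<dots> = (if k = l then 1 else 0)" using orth[OF kl] by auto
    finally show ?thesis .
  qed
  then have "distr (PiM ?T (\<lambda>_. std_gauss)) (PiM K (\<lambda>_. std_gauss)) (\<lambda>\<omega>. \<lambda>k\<in>K. \<Sum>t\<in>?T. c k t * \<omega> t)
      = PiM K (\<lambda>_. std_gauss)"
    using K by (intro distr_orthonormal_gauss) auto
  moreover have "(\<Sum>t\<in>?T. c k t * \<omega> t) = vinner n (avec \<omega> (r k)) (F k)" if k: "k \<in> K" for k \<omega>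
  proof -
    have "(\<Sum>t\<in>?T. c k t * \<omega> t) = (\<Sum>i<m. \<Sum>j<n. c k (i, j) * \<omega> (i, j))"
      by (simp add: sum.cartesian_product)
    also have "\<dots> = (\<Sum>i<m. if r k = i then vinner n (avec \<omega> (r k)) (F k) else 0)"
      by (intro sum.cong refl) (auto simp: c_def vinner_def avec_def mult.commute)
    finally show ?thesis using r[OF k] by simp
  qed
  ultimately show ?thesis unfolding gauss_sample_def by (simp cong: restrict_cong)
qed

lemma emeasure_vinner_gauss_sample:
  fixes F :: "'k \<Rightarrow> nat \<Rightarrow> real" and r :: "'k \<Rightarrow> nat"
  assumes K: "finite K" and r: "\<And>k. k \<in> K \<Longrightarrow> r k < m"
    and orth: "\<And>k l. k \<in> K \<Longrightarrow> l \<in> K \<Longrightarrow> r k = r l \<Longrightarrow> vinner n (F k) (F l) = (if k = l then 1 else 0)"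
    and B: "{v \<in> space (PiM K (\<lambda>_. std_gauss)). P v} \<in> sets (PiM K (\<lambda>_. std_gauss))"
  shows "emeasure (gauss_sample m n) {\<omega> \<in> space (gauss_sample m n). P (\<lambda>k\<in>K. vinner n (avec \<omega> (r k)) (F k))}
      = emeasure (PiM K (\<lambda>_. std_gauss)) {v \<in> space (PiM K (\<lambda>_. std_gauss)). P v}"
proof -
  let ?P = "PiM K (\<lambda>_. std_gauss)" and ?f = "\<lambda>\<omega>. \<lambda>k\<in>K. vinner n (avec \<omega> (r k)) (F k)"
  have f: "?f \<in> measurable (gauss_sample m n) ?P"
    by (rule measurable_restrict) (use r in measurable)
  have "emeasure ?P {v \<in> space ?P. P v} = emeasure (distr (gauss_sample m n) ?P ?f) {v \<in> space ?P. P v}"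
    by (subst distr_vinner_gauss_sample[OF K r orth]) auto
  also have "\<dots> = emeasure (gauss_sample m n) (?f -` {v \<in> space ?P. P v} \<inter> space (gauss_sample m n))"
    by (rule emeasure_distr[OF f B])
  also have "?f -` {v \<in> space ?P. P v} \<inter> space (gauss_sample m n) = {\<omega> \<in> space (gauss_sample m n). P (?f \<omega>)}"
    using measurable_space[OF f] by auto
  finally show ?thesis ..
qed

section \<open>Failure of balance in a fixed direction\<close>

text \<open>What the conditional estimate needs of \<open>X\<close>: a variance bound for the cross
  sums, and index sets large enough for a rate of order \<open>m\<close>.\<close>

definition regular :: "nat \<Rightarrow> real \<Rightarrow> (nat \<Rightarrow> real) \<Rightarrow> bool" where
  "regular m \<kappa> X \<longleftrightarrow> (\<Sum>i<m. (X i)\<^sup>2) \<le> 2 * real m \<and>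
     \<kappa> * real m \<le> real (card (low_idx m X)) \<and> \<kappa> * real m \<le> real (card (high_idx m X))"

text \<open>Including regularity makes the conditional probability small for every value of
  \<open>X\<close>. Irregular values are charged once, not once per net point.\<close>

definition bad_pair :: "nat \<Rightarrow> real \<Rightarrow> real \<Rightarrow> (nat \<Rightarrow> real) \<Rightarrow> (nat \<Rightarrow> real) \<Rightarrow> bool" where
  "bad_pair m \<kappa> \<epsilon> X Y \<longleftrightarrow> regular m \<kappa> X \<and>
     \<not> (balanced \<epsilon> (low_idx m X) X Y \<and> balanced \<epsilon> (high_idx m X) X Y)"

lemma low_high_idx_cong:
  assumes "\<And>i. i < m \<Longrightarrow> X i = X' i"
  shows "low_idx m X = low_idx m X'" "high_idx m X = high_idx m X'"
  using assms by (auto simp: low_idx_def high_idx_def)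

lemma bad_pair_cong:
  assumes X: "\<And>i. i < m \<Longrightarrow> X i = X' i" and Y: "\<And>i. i < m \<Longrightarrow> Y i = Y' i"
  shows "bad_pair m \<kappa> \<epsilon> X Y \<longleftrightarrow> bad_pair m \<kappa> \<epsilon> X' Y'"
proof -
  have "balanced \<epsilon> S X Y \<longleftrightarrow> balanced \<epsilon> S X' Y'" if "S \<subseteq> {..<m}" for S
  proof -
    have "(\<Sum>i\<in>S. (Y i)\<^sup>2) = (\<Sum>i\<in>S. (Y' i)\<^sup>2)" "(\<Sum>i\<in>S. X i * Y i) = (\<Sum>i\<in>S. X' i * Y' i)"
      using that X Y by (auto intro!: sum.cong)
    then show ?thesis by (simp add: balanced_def)
  qed
  moreover have "regular m \<kappa> X \<longleftrightarrow> regular m \<kappa> X'"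
    using X low_high_idx_cong[of m X X'] by (simp add: regular_def)
  ultimately show ?thesis
    using low_high_idx_cong[of m X X'] X by (simp add: bad_pair_def low_high_idx_subset)
qed

lemma measurable_bad_pair:
  assumes [measurable]: "\<And>i. i < m \<Longrightarrow> (\<lambda>\<omega>. X \<omega> i) \<in> borel_measurable M"
    "\<And>i. i < m \<Longrightarrow> (\<lambda>\<omega>. Y \<omega> i) \<in> borel_measurable M"
  shows "{\<omega> \<in> space M. bad_pair m \<kappa> \<epsilon> (X \<omega>) (Y \<omega>)} \<in> sets M"
proof -
  define R where "R \<omega> = (\<Sum>k<m. (X \<omega> k)\<^sup>2) / m / 2" for \<omega>
  have [measurable]: "R \<in> borel_measurable M" unfolding R_def by measurable
  \<comment> \<open>A sum over a random index set becomes a sum over a fixed one with measurable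
    conditions.\<close>
  have lo: "(\<Sum>i\<in>low_idx m (X \<omega>). f i) = (\<Sum>i<m. if (X \<omega> i)\<^sup>2 \<le> R \<omega> then f i else 0)" for f :: "nat \<Rightarrow> real" and \<omega>
    unfolding low_idx_def R_def[symmetric] by (rule sum.inter_filter) simp
  have hi: "(\<Sum>i\<in>high_idx m (X \<omega>). f i) = (\<Sum>i<m. if R \<omega> \<le> (X \<omega> i)\<^sup>2 then f i else 0)" for f :: "nat \<Rightarrow> real" and \<omega>
    unfolding high_idx_def R_def[symmetric] by (rule sum.inter_filter) simp
  have card: "real (card S) = (\<Sum>i\<in>S. 1)" for S :: "nat set" by simp
  have [measurable]:
    "(\<lambda>\<omega>. real (card (low_idx m (X \<omega>)))) \<in> borel_measurable M"
    "(\<lambda>\<omega>. \<Sum>i\<in>low_idx m (X \<omega>). (Y \<omega> i)\<^sup>2) \<in> borel_measurable M"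
    "(\<lambda>\<omega>. \<Sum>i\<in>low_idx m (X \<omega>). X \<omega> i * Y \<omega> i) \<in> borel_measurable M"
    unfolding card lo by measurable
  have [measurable]:
    "(\<lambda>\<omega>. real (card (high_idx m (X \<omega>)))) \<in> borel_measurable M"
    "(\<lambda>\<omega>. \<Sum>i\<in>high_idx m (X \<omega>). (Y \<omega> i)\<^sup>2) \<in> borel_measurable M"
    "(\<lambda>\<omega>. \<Sum>i\<in>high_idx m (X \<omega>). X \<omega> i * Y \<omega> i) \<in> borel_measurable M"
    unfolding card hi by measurable
  have [measurable]: "(\<lambda>\<omega>. \<Sum>i<m. (X \<omega> i)\<^sup>2) \<in> borel_measurable M" by measurable
  show ?thesis
    unfolding bad_pair_def regular_def balanced_def by measurable
qed

text \<open>The sum of squares fails with exponent at least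
  \<open>\<epsilon>\<^sup>2 * \<kappa> / 16\<close> per sample. The cross sum, of variance at most
  \<open>2 * m\<close>, fails with exponent at least
  \<open>\<epsilon>\<^sup>2 * \<kappa>\<^sup>2 / 4\<close>. The stated rate is below both, and each
  event costs two tails.\<close>

lemma gauss_PiM_unbalanced:
  assumes S: "S \<subseteq> {..<m}" and c: "\<kappa> * real m \<le> real (card S)" and \<kappa>: "0 < \<kappa>" "\<kappa> \<le> 1"
    and \<epsilon>: "0 < \<epsilon>" "\<epsilon> \<le> 1" and x: "(\<Sum>i<m. (x i)\<^sup>2) \<le> 2 * real m" and m: "0 < m"
  shows "emeasure (PiM (Pair b ` {..<m}) (\<lambda>_. std_gauss))
      {y \<in> space (PiM (Pair b ` {..<m}) (\<lambda>_. std_gauss)). \<not> balanced \<epsilon> S x (\<lambda>i. y (b, i))}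
      \<le> ennreal (4 * exp (- (\<epsilon>\<^sup>2 * \<kappa>\<^sup>2 / 16) * real m))"
proof -
  let ?J = "Pair b ` {..<m}" let ?P = "PiM ?J (\<lambda>_. std_gauss)" and ?S = "Pair b ` S"
  have J: "finite ?J" "?S \<subseteq> ?J" using S by auto
  have inj: "inj_on (Pair b) S" by (simp add: inj_on_def)
  have cS: "card ?S = card S" by (rule card_image[OF inj])
  have c0: "0 < real (card S)" using c \<kappa> m by (smt (verit) mult_pos_pos of_nat_0_less_iff)
  have [measurable]: "(\<lambda>y. \<Sum>j\<in>?S. (y j)\<^sup>2) \<in> borel_measurable ?P" "(\<lambda>y. \<Sum>j\<in>?S. x (snd j) * y j) \<in> borel_measurable ?P"
    using J by (intro borel_measurable_sum borel_measurable_power borel_measurable_times;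
      auto intro: measurable_component_singleton)+
  define B1 where "B1 = {y \<in> space ?P. \<epsilon> * card ?S < \<bar>(\<Sum>j\<in>?S. (y j)\<^sup>2) - card ?S\<bar>}"
  define B2 where "B2 = {y \<in> space ?P. \<epsilon> * card S < \<bar>\<Sum>j\<in>?S. x (snd j) * y j\<bar>}"
  have B: "B1 \<in> sets ?P" "B2 \<in> sets ?P" unfolding B1_def B2_def by measurable
  have 1: "emeasure ?P B1 \<le> ennreal (2 * exp (- (\<epsilon>\<^sup>2 * \<kappa>\<^sup>2 / 16) * real m))"
    unfolding B1_def
  proof (rule order_trans[OF gauss_PiM_square_concentration[OF J \<epsilon>]], intro ennreal_leI)
    have "\<kappa>\<^sup>2 * real m \<le> \<kappa> * real m"
      using \<kappa> by (intro mult_right_mono) (auto simp: power2_eq_square mult_left_le)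
    then have "\<kappa>\<^sup>2 * real m \<le> card S" using c by linarith
    then have "\<epsilon>\<^sup>2 / 16 * (\<kappa>\<^sup>2 * real m) \<le> \<epsilon>\<^sup>2 / 16 * card S" by (intro mult_left_mono) auto
    then show "2 * exp (- (\<epsilon>\<^sup>2 / 16) * real (card ?S)) \<le> 2 * exp (- (\<epsilon>\<^sup>2 * \<kappa>\<^sup>2 / 16) * real m)"
      by (simp add: cS)
  qed
  have 2: "emeasure ?P B2 \<le> ennreal (2 * exp (- (\<epsilon>\<^sup>2 * \<kappa>\<^sup>2 / 16) * real m))"
    unfolding B2_def
  proof (rule order_trans[OF gauss_PiM_linear_concentration[OF J, where V="2 * real m"]], goal_cases)
    case 1
    then show ?case using \<epsilon> c0 by simp
  next
    case 2
    then show ?case using m by simp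
  next
    case 3
    have "(\<Sum>j\<in>?S. (x (snd j))\<^sup>2) = (\<Sum>i\<in>S. (x i)\<^sup>2)" by (simp add: sum.reindex[OF inj])
    also have "\<dots> \<le> (\<Sum>i<m. (x i)\<^sup>2)" using S by (intro sum_mono2) auto
    finally show ?case using x by linarith
  next
    case 4
    have "\<epsilon>\<^sup>2 * \<kappa>\<^sup>2 / 16 * real m \<le> \<epsilon>\<^sup>2 * \<kappa>\<^sup>2 / 4 * real m" by (intro mult_right_mono) auto
    also have "\<dots> = (\<epsilon> * (\<kappa> * real m))\<^sup>2 / (2 * (2 * real m))"
      using m by (simp add: power2_eq_square field_simps)
    also have "\<dots> \<le> (\<epsilon> * card S)\<^sup>2 / (2 * (2 * real m))"
      using c \<epsilon> \<kappa> by (intro divide_right_mono power_mono mult_left_mono) auto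
    finally show ?case by (intro ennreal_leI) simp
  qed
  have "emeasure ?P {y \<in> space ?P. \<not> balanced \<epsilon> S x (\<lambda>i. y (b, i))}
      \<le> ennreal (2 * exp (- (\<epsilon>\<^sup>2 * \<kappa>\<^sup>2 / 16) * real m) + 2 * exp (- (\<epsilon>\<^sup>2 * \<kappa>\<^sup>2 / 16) * real m))"
    by (rule emeasure_le_two_sets[OF _ B 1 2])
       (auto simp: B1_def B2_def balanced_def sum.reindex[OF inj] cS)
  then show ?thesis by simp
qed

text \<open>Conditionally on \<open>X\<close> the index sets are fixed, and \<open>Y\<close> is still standard Gaussian.\<close>

lemma gauss_PiM_bad_pair:
  assumes \<kappa>: "0 < \<kappa>" "\<kappa> \<le> 1" and \<epsilon>: "0 < \<epsilon>" "\<epsilon> \<le> 1" and m: "0 < m"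
  defines "K \<equiv> Pair True ` {..<m} \<union> Pair False ` {..<m}"
  shows "emeasure (PiM K (\<lambda>_. std_gauss))
      {v \<in> space (PiM K (\<lambda>_. std_gauss)). bad_pair m \<kappa> \<epsilon> (\<lambda>i. v (True, i)) (\<lambda>i. v (False, i))}
      \<le> ennreal (8 * exp (- (\<epsilon>\<^sup>2 * \<kappa>\<^sup>2 / 16) * real m))"
proof -
  let ?I = "Pair True ` {..<m}" and ?J = "Pair False ` {..<m}"
  let ?P = "PiM K (\<lambda>_. std_gauss)" and ?PI = "PiM ?I (\<lambda>_. std_gauss)" and ?PJ = "PiM ?J (\<lambda>_. std_gauss)"
  let ?c = "\<epsilon>\<^sup>2 * \<kappa>\<^sup>2 / 16"
  interpret PI: prob_space ?PI by (intro prob_space_PiM prob_space_std_gauss)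
  define Bad where "Bad = {v \<in> space ?P. bad_pair m \<kappa> \<epsilon> (\<lambda>i. v (True, i)) (\<lambda>i. v (False, i))}"
  have Bad: "Bad \<in> sets ?P"
    unfolding Bad_def
    by (rule measurable_bad_pair) (auto simp: K_def intro!: measurable_component_singleton)
  have "emeasure ?P Bad = (\<integral>\<^sup>+v. indicator Bad v \<partial>?P)" using Bad by simp
  also have "\<dots> = (\<integral>\<^sup>+x. (\<integral>\<^sup>+y. indicator Bad (merge ?I ?J (x, y)) \<partial>?PJ) \<partial>?PI)"
    unfolding K_def by (rule gauss_PiM.product_nn_integral_fold) (use Bad in \<open>auto simp: K_def\<close>)
  also have "\<dots> \<le> (\<integral>\<^sup>+x. ennreal (8 * exp (- ?c * real m)) \<partial>?PI)"
  proof (intro nn_integral_mono)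
    fix x assume x: "x \<in> space ?PI"
    let ?X = "\<lambda>i. x (True, i)"
    have bp: "bad_pair m \<kappa> \<epsilon> (\<lambda>i. merge ?I ?J (x, y) (True, i)) (\<lambda>i. merge ?I ?J (x, y) (False, i))
        \<longleftrightarrow> bad_pair m \<kappa> \<epsilon> ?X (\<lambda>i. y (False, i))" for y
      by (rule bad_pair_cong) (auto simp: merge_def)
    have sec: "{y \<in> space ?PJ. bad_pair m \<kappa> \<epsilon> ?X (\<lambda>i. y (False, i))} \<in> sets ?PJ"
      by (rule measurable_bad_pair) (auto intro!: measurable_component_singleton)
    have "(\<integral>\<^sup>+y. indicator Bad (merge ?I ?J (x, y)) \<partial>?PJ)
        \<le> (\<integral>\<^sup>+y. indicator {y \<in> space ?PJ. bad_pair m \<kappa> \<epsilon> ?X (\<lambda>i. y (False, i))} y \<partial>?PJ)"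
      by (intro nn_integral_mono) (auto simp: indicator_def Bad_def bp)
    also have "\<dots> = emeasure ?PJ {y \<in> space ?PJ. bad_pair m \<kappa> \<epsilon> ?X (\<lambda>i. y (False, i))}"
      using sec by simp
    also have "\<dots> \<le> ennreal (8 * exp (- ?c * real m))"
    \<comment> \<open>An irregular \<open>x\<close> has an empty section. For a regular one, failure
      on either of two now fixed sets costs 4 + 4.\<close>
    proof (cases "regular m \<kappa> ?X")
      case False
      then show ?thesis by (simp add: bad_pair_def)
    next
      case True
      then have r: "(\<Sum>i<m. (?X i)\<^sup>2) \<le> 2 * real m" "\<kappa> * real m \<le> real (card (low_idx m ?X))"
        "\<kappa> * real m \<le> real (card (high_idx m ?X))" by (auto simp: regular_def)
      have ms: "{y \<in> space ?PJ. \<not> balanced \<epsilon> S ?X (\<lambda>i. y (False, i))} \<in> sets ?PJ" if "S \<subseteq> {..<m}" for S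
      proof -
        have [measurable]: "(\<lambda>y. y (False, i)) \<in> borel_measurable ?PJ" if "i \<in> S" for i
          using that \<open>S \<subseteq> {..<m}\<close> by (auto intro!: measurable_component_singleton)
        show ?thesis unfolding balanced_def by measurable
      qed
      have "emeasure ?PJ {y \<in> space ?PJ. bad_pair m \<kappa> \<epsilon> ?X (\<lambda>i. y (False, i))}
          \<le> ennreal (4 * exp (- ?c * real m) + 4 * exp (- ?c * real m))"
        by (rule emeasure_le_two_sets[OF _ ms[OF low_high_idx_subset(1)] ms[OF low_high_idx_subset(2)]
            gauss_PiM_unbalanced[OF low_high_idx_subset(1) r(2) \<kappa> \<epsilon> r(1) m]
            gauss_PiM_unbalanced[OF low_high_idx_subset(2) r(3) \<kappa> \<epsilon> r(1) m]])
           (auto simp: bad_pair_def)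
      then show ?thesis by simp
    qed
    finally show "(\<integral>\<^sup>+y. indicator Bad (merge ?I ?J (x, y)) \<partial>?PJ) \<le> ennreal (8 * exp (- ?c * real m))" .
  qed
  also have "\<dots> = ennreal (8 * exp (- ?c * real m))" by (simp add: PI.emeasure_space_1)
  finally show ?thesis by (simp add: Bad_def)
qed

lemma gauss_sample_bad_pair:
  assumes \<kappa>: "0 < \<kappa>" "\<kappa> \<le> 1" and \<epsilon>: "0 < \<epsilon>" "\<epsilon> \<le> 1" and m: "0 < m"
    and e: "vnorm n e = 1" and w: "vnorm n w = 1" and ew: "vinner n e w = 0"
  shows "emeasure (gauss_sample m n) {\<omega> \<in> space (gauss_sample m n).
        bad_pair m \<kappa> \<epsilon> (\<lambda>i. vinner n (avec \<omega> i) e) (\<lambda>i. vinner n (avec \<omega> i) w)}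
      \<le> ennreal (8 * exp (- (\<epsilon>\<^sup>2 * \<kappa>\<^sup>2 / 16) * real m))"
proof -
  \<comment> \<open>The tag \<open>True\<close> marks components along \<open>e\<close>, the tag
    \<open>False\<close> those along \<open>w\<close>. Orthogonality of \<open>e\<close> and
    \<open>w\<close> makes all \<open>2 * m\<close> of them independent standard normals.\<close>
  define K where "K = Pair True ` {..<m} \<union> Pair False ` {..<m}"
  define F where "F k = (if fst k then e else w)" for k :: "bool \<times> nat"
  have ee: "vinner n e e = 1" "vinner n w w = 1" "vinner n w e = 0"
    using e w ew vnorm_power2[of n e] vnorm_power2[of n w] by (simp_all add: vinner_commute)
  have "emeasure (gauss_sample m n) {\<omega> \<in> space (gauss_sample m n).
        bad_pair m \<kappa> \<epsilon> (\<lambda>i. vinner n (avec \<omega> i) e) (\<lambda>i. vinner n (avec \<omega> i) w)}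
      = emeasure (gauss_sample m n) {\<omega> \<in> space (gauss_sample m n).
        bad_pair m \<kappa> \<epsilon> (\<lambda>i. (\<lambda>k\<in>K. vinner n (avec \<omega> (snd k)) (F k)) (True, i))
          (\<lambda>i. (\<lambda>k\<in>K. vinner n (avec \<omega> (snd k)) (F k)) (False, i))}"
    by (intro arg_cong2[where f=emeasure] refl Collect_cong conj_cong bad_pair_cong)
       (auto simp: K_def F_def)
  also have "\<dots> = emeasure (PiM K (\<lambda>_. std_gauss))
      {v \<in> space (PiM K (\<lambda>_. std_gauss)). bad_pair m \<kappa> \<epsilon> (\<lambda>i. v (True, i)) (\<lambda>i. v (False, i))}"
  proof (rule emeasure_vinner_gauss_sample[where P="\<lambda>v. bad_pair m \<kappa> \<epsilon> (\<lambda>i. v (True, i)) (\<lambda>i. v (False, i))"])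
    show "{v \<in> space (PiM K (\<lambda>_. std_gauss)). bad_pair m \<kappa> \<epsilon> (\<lambda>i. v (True, i)) (\<lambda>i. v (False, i))}
        \<in> sets (PiM K (\<lambda>_. std_gauss))"
      by (rule measurable_bad_pair) (auto simp: K_def intro!: measurable_component_singleton)
  qed (auto simp: K_def F_def ee ew)
  also have "\<dots> \<le> ennreal (8 * exp (- (\<epsilon>\<^sup>2 * \<kappa>\<^sup>2 / 16) * real m))"
    unfolding K_def by (rule gauss_PiM_bad_pair[OF \<kappa> \<epsilon> m])
  finally show ?thesis .
qed

section \<open>Typical behaviour of the components along \<open>e\<close>\<close>

text \<open>Counts in the fixed intervals are binomial, unlike the cardinalities of the random index
  sets, which they bound from below.\<close>

definition typical :: "nat \<Rightarrow> real \<Rightarrow> real \<Rightarrow> (nat \<Rightarrow> real) \<Rightarrow> bool" where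
  "typical m \<kappa> \<epsilon> X \<longleftrightarrow> \<bar>(\<Sum>i\<in>{..<m}. (X i)\<^sup>2) - real (card {..<m})\<bar> \<le> \<epsilon> * real (card {..<m}) \<and>
     \<kappa> * real (card {..<m}) \<le> real (card {i \<in> {..<m}. X i \<in> {0..1/2}}) \<and>
     \<kappa> * real (card {..<m}) \<le> real (card {i \<in> {..<m}. X i \<in> {1..2}})"

lemma typical_cong:
  assumes X: "\<And>i. i < m \<Longrightarrow> X i = X' i"
  shows "typical m \<kappa> \<epsilon> X \<longleftrightarrow> typical m \<kappa> \<epsilon> X'"
proof -
  have "{i \<in> {..<m}. X i \<in> A} = {i \<in> {..<m}. X' i \<in> A}" for A using X by auto
  moreover have "(\<Sum>i\<in>{..<m}. (X i)\<^sup>2) = (\<Sum>i\<in>{..<m}. (X' i)\<^sup>2)" using X by simp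
  ultimately show ?thesis by (simp only: typical_def)
qed

lemma measurable_card_mem:
  fixes m :: nat
  assumes [measurable]: "\<And>i. i < m \<Longrightarrow> (\<lambda>\<omega>. X \<omega> i) \<in> borel_measurable M" and [measurable]: "A \<in> sets borel"
  shows "(\<lambda>\<omega>. real (card {i \<in> {..<m}. X \<omega> i \<in> A})) \<in> borel_measurable M"
proof -
  have "real (card {i \<in> {..<m}. X \<omega> i \<in> A}) = (\<Sum>i<m. if X \<omega> i \<in> A then 1 else 0)" for \<omega>
    by (subst sum.inter_filter[symmetric]) simp_all
  then show ?thesis by simp
qed

lemma measurable_typical:
  assumes [measurable]: "\<And>i. i < m \<Longrightarrow> (\<lambda>\<omega>. X \<omega> i) \<in> borel_measurable M"
  shows "{\<omega> \<in> space M. \<not> typical m \<kappa> \<epsilon> (X \<omega>)} \<in> sets M"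
proof -
  note [measurable] = measurable_card_mem[of m X M, OF assms]
  show ?thesis unfolding typical_def by measurable
qed

lemma gauss_sample_typical:
  obtains \<kappa> where "0 < \<kappa>" "\<kappa> \<le> 1"
    "\<And>m n e \<epsilon>. vnorm n e = 1 \<Longrightarrow> 0 < \<epsilon> \<Longrightarrow> \<epsilon> \<le> 1 \<Longrightarrow>
      emeasure (gauss_sample m n)
        {\<omega> \<in> space (gauss_sample m n). \<not> typical m \<kappa> \<epsilon> (\<lambda>i. vinner n (avec \<omega> i) e)}
      \<le> ennreal (2 * exp (- (\<epsilon>\<^sup>2 / 16) * real m) + 2 * exp (- \<kappa> * real m))"
proof -
  obtain \<kappa>1 \<kappa>2 :: real where k1: "0 < \<kappa>1" and k2: "0 < \<kappa>2"
    and c1: "\<And>J::nat set. finite J \<Longrightarrow> emeasure (PiM J (\<lambda>_. std_gauss))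
      {y \<in> space (PiM J (\<lambda>_. std_gauss)). real (card {j \<in> J. y j \<in> {0..1/2}}) < \<kappa>1 * card J}
      \<le> ennreal (exp (- \<kappa>1 * card J))"
    and c2: "\<And>J::nat set. finite J \<Longrightarrow> emeasure (PiM J (\<lambda>_. std_gauss))
      {y \<in> space (PiM J (\<lambda>_. std_gauss)). real (card {j \<in> J. y j \<in> {1..2}}) < \<kappa>2 * card J}
      \<le> ennreal (exp (- \<kappa>2 * card J))"
    using gauss_PiM_count_lower[OF _ emeasure_std_gauss_interval_pos[of 0 "1/2"], where 'j=nat]
      gauss_PiM_count_lower[OF _ emeasure_std_gauss_interval_pos[of 1 2], where 'j=nat] by auto
  \<comment> \<open>A smaller constant shrinks the failure events and weakens the rates, so both
    count bounds survive the minimum. The cap 1 makes the square of \<kappa> at most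
    \<kappa>.\<close>
  define \<kappa> where "\<kappa> = min 1 (min \<kappa>1 \<kappa>2)"
  have k: "0 < \<kappa>" "\<kappa> \<le> 1" "\<kappa> \<le> \<kappa>1" "\<kappa> \<le> \<kappa>2" using k1 k2 by (auto simp: \<kappa>_def)
  have "emeasure (gauss_sample m n) {\<omega> \<in> space (gauss_sample m n). \<not> typical m \<kappa> \<epsilon> (\<lambda>i. vinner n (avec \<omega> i) e)}
      \<le> ennreal (2 * exp (- (\<epsilon>\<^sup>2 / 16) * real m) + 2 * exp (- \<kappa> * real m))"
    if e: "vnorm n e = 1" and \<epsilon>: "0 < \<epsilon>" "\<epsilon> \<le> 1" for m n e \<epsilon>
  proof -
    let ?P = "PiM {..<m} (\<lambda>_. std_gauss)"
    have comp [measurable]: "(\<lambda>y. y i) \<in> borel_measurable ?P" if "i < m" for i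
      using that by (auto intro!: measurable_component_singleton)
    have ee: "vinner n e e = 1" using e vnorm_power2[of n e] by simp
    have "emeasure (gauss_sample m n) {\<omega> \<in> space (gauss_sample m n). \<not> typical m \<kappa> \<epsilon> (\<lambda>i. vinner n (avec \<omega> i) e)}
        = emeasure (gauss_sample m n) {\<omega> \<in> space (gauss_sample m n). \<not> typical m \<kappa> \<epsilon> (\<lambda>i\<in>{..<m}. vinner n (avec \<omega> i) e)}"
      by (intro arg_cong2[where f=emeasure] refl Collect_cong conj_cong arg_cong[where f=Not] typical_cong) auto
    also have "\<dots> = emeasure ?P {v \<in> space ?P. \<not> typical m \<kappa> \<epsilon> v}"
      by (rule emeasure_vinner_gauss_sample[where r="\<lambda>i. i"]) (auto simp: ee intro!: measurable_typical comp)
    also have "\<dots> \<le> ennreal (2 * exp (- (\<epsilon>\<^sup>2 / 16) * real m) + 2 * exp (- \<kappa> * real m))"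
    proof -
      define B1 where "B1 = {y \<in> space ?P. \<epsilon> * card {..<m} < \<bar>(\<Sum>j\<in>{..<m}. (y j)\<^sup>2) - card {..<m}\<bar>}"
      define C where "C A \<kappa> = {y \<in> space ?P. real (card {j \<in> {..<m}. y j \<in> A}) < \<kappa> * card {..<m}}" for A and \<kappa> :: real
      have B1: "B1 \<in> sets ?P" unfolding B1_def by measurable
      have C: "C A \<kappa> \<in> sets ?P" if "A \<in> sets borel" for A \<kappa>
      proof -
        note [measurable] = measurable_card_mem[of m "\<lambda>y. y", OF comp that]
        show ?thesis unfolding C_def by measurable
      qed
      have e1: "emeasure ?P B1 \<le> ennreal (2 * exp (- (\<epsilon>\<^sup>2 / 16) * real m))"
        using gauss_PiM_square_concentration[of "{..<m}" "{..<m}", OF _ _ \<epsilon>] by (simp add: B1_def)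
      have eC: "emeasure ?P (C A \<kappa>) \<le> ennreal (exp (- \<kappa> * real m))"
        if A: "A \<in> sets borel" and bd: "emeasure ?P (C A \<kappa>') \<le> ennreal (exp (- \<kappa>' * card {..<m}))" and \<kappa>': "\<kappa> \<le> \<kappa>'"
        for A \<kappa>'
      proof -
        have le: "\<kappa> * real m \<le> \<kappa>' * real m" using \<kappa>' by (intro mult_right_mono) auto
        have "emeasure ?P (C A \<kappa>) \<le> emeasure ?P (C A \<kappa>')"
          using le by (intro emeasure_mono C[OF A]) (auto simp: C_def)
        also have "\<dots> \<le> ennreal (exp (- \<kappa>' * card {..<m}))" by (rule bd)
        also have "\<dots> \<le> ennreal (exp (- \<kappa> * real m))" using le by (intro ennreal_leI) simp
        finally show ?thesis .
      qed
      have eC1: "emeasure ?P (C {0..1/2} \<kappa>) \<le> ennreal (exp (- \<kappa> * real m))"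
        by (rule eC[OF _ _ k(3)]) (use c1[of "{..<m}"] in \<open>auto simp: C_def\<close>)
      have eC2: "emeasure ?P (C {1..2} \<kappa>) \<le> ennreal (exp (- \<kappa> * real m))"
        by (rule eC[OF _ _ k(4)]) (use c2[of "{..<m}"] in \<open>auto simp: C_def\<close>)
      have eC12: "emeasure ?P (C {0..1/2} \<kappa> \<union> C {1..2} \<kappa>) \<le> ennreal (exp (- \<kappa> * real m) + exp (- \<kappa> * real m))"
        by (rule emeasure_le_two_sets[OF _ C C eC1 eC2]) auto
      have "emeasure ?P {v \<in> space ?P. \<not> typical m \<kappa> \<epsilon> v}
          \<le> ennreal (2 * exp (- (\<epsilon>\<^sup>2 / 16) * real m) + (exp (- \<kappa> * real m) + exp (- \<kappa> * real m)))"
        by (rule emeasure_le_two_sets[OF _ B1 _ e1 eC12])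
           (auto simp: typical_def B1_def C_def[of "{0..1/2}"] C_def[of "{1..2}"] not_le intro!: sets.Un C)
      then show ?thesis by simp
    qed
    finally show ?thesis .
  qed
  then show ?thesis by (rule that[OF k(1,2)])
qed

text \<open>For \<open>\<epsilon> \<le> 1/2\<close> the threshold \<open>R / 2\<close> lies between
  1/4 and 3/4. Hence values in \<open>{0..1/2}\<close> have squares below it and values in
  \<open>{1..2}\<close> have squares above it.\<close>

lemma typical_imp_regular:
  assumes t: "typical m \<kappa> \<epsilon> X" and \<epsilon>: "\<epsilon> \<le> 1/2" and m: "0 < m"
  shows "regular m \<kappa> X" and "\<bar>(\<Sum>i<m. (X i)\<^sup>2) / m - 1\<bar> \<le> \<epsilon>"
proof -
  define R where "R = (\<Sum>i<m. (X i)\<^sup>2) / m"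
  have sum: "(\<Sum>i<m. (X i)\<^sup>2) = R * m" using m by (simp add: R_def)
  have "\<bar>R - 1\<bar> * m = \<bar>(R - 1) * m\<bar>" by (simp add: abs_mult)
  also have "(R - 1) * m = (\<Sum>i<m. (X i)\<^sup>2) - m" by (simp add: sum left_diff_distrib)
  also have "\<bar>\<dots>\<bar> \<le> \<epsilon> * m" using t by (simp add: typical_def)
  finally have "\<bar>R - 1\<bar> * m \<le> \<epsilon> * m" .
  then have R: "\<bar>R - 1\<bar> \<le> \<epsilon>" using m by simp
  then show "\<bar>(\<Sum>i<m. (X i)\<^sup>2) / m - 1\<bar> \<le> \<epsilon>" by (simp add: R_def)
  have "{i \<in> {..<m}. X i \<in> {0..1/2}} \<subseteq> low_idx m X"
  proof
    fix i assume i: "i \<in> {i \<in> {..<m}. X i \<in> {0..1/2}}"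
    then have "(X i)\<^sup>2 \<le> (1/2)\<^sup>2" by (intro power_mono) auto
    also have "\<dots> \<le> R / 2" using R \<epsilon> by (simp add: power2_eq_square abs_le_iff)
    finally show "i \<in> low_idx m X" using i by (simp add: low_idx_def R_def)
  qed
  then have 1: "card {i \<in> {..<m}. X i \<in> {0..1/2}} \<le> card (low_idx m X)"
    by (intro card_mono finite_low_high_idx)
  have "{i \<in> {..<m}. X i \<in> {1..2}} \<subseteq> high_idx m X"
  proof
    fix i assume i: "i \<in> {i \<in> {..<m}. X i \<in> {1..2}}"
    have "R / 2 \<le> 1\<^sup>2" using R \<epsilon> by (simp add: abs_le_iff)
    also have "\<dots> \<le> (X i)\<^sup>2" using i by (intro power_mono) auto
    finally show "i \<in> high_idx m X" using i by (simp add: high_idx_def R_def)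
  qed
  then have 2: "card {i \<in> {..<m}. X i \<in> {1..2}} \<le> card (high_idx m X)"
    by (intro card_mono finite_low_high_idx)
  have "R * real m \<le> 2 * real m" using R \<epsilon> by (intro mult_right_mono) (auto simp: abs_le_iff)
  then show "regular m \<kappa> X"
    using t 1 2 unfolding regular_def typical_def sum by auto
qed

section \<open>From the good event to the error bound\<close>

definition netdir :: "nat \<Rightarrow> nat \<Rightarrow> (nat \<Rightarrow> real) \<Rightarrow> (nat \<Rightarrow> int) \<Rightarrow> nat \<Rightarrow> real" where
  "netdir n k e v = (\<lambda>j. netvec n k e v j / vnorm n (netvec n k e v))"

lemma netdir_unit_perp:
  assumes e: "vnorm n e = 1" and nz: "vnorm n (netvec n k e v) \<noteq> 0"
  shows "vnorm n (netdir n k e v) = 1" and "vinner n e (netdir n k e v) = 0"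
proof -
  have d: "netdir n k e v = (\<lambda>j. 1 / vnorm n (netvec n k e v) * netvec n k e v j)"
    by (simp add: netdir_def)
  show "vnorm n (netdir n k e v) = 1"
    unfolding d vnorm_scale using nz vnorm_nonneg[of n "netvec n k e v"] by simp
  show "vinner n e (netdir n k e v) = 0"
    unfolding d vinner_scale_right by (simp add: netvec_def vinner_perp[OF e])
qed

text \<open>The deterministic half of the theorem. The number 33 is 1 + 4 * 8: \<epsilon> for the
  radius, and four times the angle bound with its factor 8. The net is used at accuracy
  \<open>\<epsilon> / 10\<close>, as the extension to the sphere costs a factor 10.\<close>

lemma pdist_le_of_good_event:
  fixes lm lp \<delta> \<epsilon> \<kappa> :: real and m n k :: nat and e x :: "nat \<Rightarrow> real" and \<omega> :: "nat \<times> nat \<Rightarrow> real"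
  defines "X \<equiv> \<lambda>i. vinner n (avec \<omega> i) e"
  assumes lmp: "lm < 0" "lp > 0" and \<delta>: "\<delta> < 1"
    and \<epsilon>: "0 < \<epsilon>" "33 * \<epsilon> * (lp - lm) \<le> \<delta> * (- lm)"
    and m: "0 < m" and n: "0 < n" and \<kappa>: "0 < \<kappa>" and k: "0 < k" "1 / real k \<le> \<epsilon> / 10"
    and x: "\<And>j. x j = b * e j" "b > 0" and e: "vnorm n e = 1" "\<And>j. n \<le> j \<Longrightarrow> e j = 0"
    and typical: "typical m \<kappa> \<epsilon> X"
    and good: "\<And>v. v \<in> grid n (k\<^sup>2 * n) \<Longrightarrow> vnorm n (netvec n k e v) \<noteq> 0 \<Longrightarrow>
      \<not> bad_pair m \<kappa> (\<epsilon> / 10) X (\<lambda>i. vinner n (avec \<omega> i) (netdir n k e v))"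
    and d: "is_dhat lm lp m n \<omega> x d"
  shows "pdist n (\<lambda>j. rhat m n \<omega> x * d j) x \<le> \<delta> * b"
proof -
  \<comment> \<open>Since \<open>- lm < lp - lm\<close> and \<open>\<delta> < 1\<close>, the
    hypothesis on \<epsilon> also yields every absolute smallness condition used below.\<close>
  have "33 * \<epsilon> * (lp - lm) \<le> 1 * (- lm)"
    by (rule order_trans[OF \<epsilon>(2) mult_right_mono]) (use \<delta> lmp in auto)
  also have "\<dots> \<le> lp - lm" using lmp by simp
  finally have "33 * \<epsilon> * (lp - lm) \<le> 1 * (lp - lm)" by simp
  then have \<epsilon>33: "33 * \<epsilon> \<le> 1" using lmp by (simp only: mult_le_cancel_right)
  have \<epsilon>l: "0 \<le> \<epsilon> * (lp - lm)" using \<epsilon> lmp by simp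
  have \<epsilon>8: "8 * \<epsilon> * (lp - lm) \<le> - lm"
    using \<open>33 * \<epsilon> * (lp - lm) \<le> 1 * (- lm)\<close> \<epsilon>l by linarith
  define L where "L = low_idx m X"
  define H where "H = high_idx m X"
  have reg: "regular m \<kappa> X" and R: "\<bar>(\<Sum>i<m. (X i)\<^sup>2) / m - 1\<bar> \<le> \<epsilon>"
    using typical_imp_regular[OF typical _ m] \<epsilon>33 by auto
  have "0 < \<kappa> * real m" using \<kappa> m by simp
  then have "0 < real (card L)" "0 < real (card H)"
    using reg unfolding regular_def L_def H_def by linarith+
  then have ne: "L \<noteq> {}" "H \<noteq> {}" by auto
  have iso: "balanced \<epsilon> S X (\<lambda>i. vinner n (avec \<omega> i) z)"
    if z: "vinner n e z = 0" "vnorm n z = 1" and S: "S = L \<or> S = H" for z S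
  proof -
    have "balanced (10 * (\<epsilon> / 10)) S X (\<lambda>i. vinner n (avec \<omega> i) z)"
    proof (rule balanced_of_net[OF n k _ _ e(1) _ z])
      show "\<epsilon> / 10 \<le> 1 / 10" using \<epsilon>33 by simp
      show "finite S" using S finite_low_high_idx by (auto simp: L_def H_def)
      fix v assume "v \<in> grid n (k\<^sup>2 * n)" "vnorm n (netvec n k e v) \<noteq> 0"
      then have "balanced (\<epsilon> / 10) S X (\<lambda>i. vinner n (avec \<omega> i) (netdir n k e v))"
        using good reg S by (auto simp: bad_pair_def L_def H_def)
      then show "balanced (\<epsilon> / 10) S X
          (\<lambda>i. vinner n (avec \<omega> i) (\<lambda>j. netvec n k e v j / vnorm n (netvec n k e v)))"
        by (simp add: balanced_def netdir_def)
    qed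
    then show ?thesis by simp
  qed
  have quad: "quadY lm lp m n \<omega> x z = quad2 lm lp n L H (avec \<omega>) z" for z
    unfolding quadY_def quad2_def
      rhat_Iminus_Iplus_normalized(2)[OF x] rhat_Iminus_Iplus_normalized(3)[OF x]
      L_def H_def X_def ..
  have d1: "vnorm n d = 1" and max: "quad2 lm lp n L H (avec \<omega>) e \<le> quad2 lm lp n L H (avec \<omega>) d"
    using d e by (auto simp: is_dhat_def unit_sphere_n_def quad)
  have \<beta>: "vnorm n (perp n e d) \<le> 8 * \<epsilon> * (lp - lm) / (- lm)"
    using maximizer_perp_bound[OF lmp \<epsilon>(1) \<epsilon>8 e(1) d1, of m "avec \<omega>"] ne R iso max
    unfolding X_def L_def H_def by blast
  define r where "r = sqrt ((\<Sum>i<m. (X i)\<^sup>2) / m)"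
  have r: "0 \<le> r" "\<bar>r\<^sup>2 - 1\<bar> \<le> \<epsilon>" using R by (simp_all add: r_def sum_nonneg)
  have "rhat m n \<omega> x = b * r"
    unfolding r_def X_def by (rule rhat_Iminus_Iplus_normalized(1)[OF x])
  then have "pdist n (\<lambda>j. rhat m n \<omega> x * d j) x \<le> (\<epsilon> + 4 * vnorm n (perp n e d)) * b"
    using pdist_scaled_direction[OF e(1) d1 r _ x] \<epsilon>33 by simp
  also have "\<dots> \<le> \<delta> * b"
  proof (rule mult_right_mono)
    have "\<epsilon> * (- lm) \<le> \<epsilon> * (lp - lm)" using lmp \<epsilon> by (intro mult_left_mono) auto
    then have "\<epsilon> \<le> \<epsilon> * (lp - lm) / (- lm)" using lmp by (simp only: pos_le_divide_eq neg_0_less_iff_less)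
    then have "\<epsilon> + 4 * vnorm n (perp n e d) \<le> \<epsilon> * (lp - lm) / (- lm) + 4 * (8 * \<epsilon> * (lp - lm) / (- lm))"
      using \<beta> by linarith
    also have "\<dots> = 33 * \<epsilon> * (lp - lm) / (- lm)" by simp
    also have "\<dots> \<le> \<delta>" using \<epsilon>(2) lmp by (simp only: pos_divide_le_eq neg_0_less_iff_less)
    finally show "\<epsilon> + 4 * vnorm n (perp n e d) \<le> \<delta>" .
  qed (use x in simp)
  finally show ?thesis .
qed

lemma card_grid_exp: "real (card (grid n (k\<^sup>2 * n))) \<le> exp ((real (k\<^sup>2) + 2) * real n)"
proof -
  have "(2::real) \<le> exp 1" using exp_ge_add_one_self[of 1] by simp
  have "(3::real) \<le> exp 2" using exp_ge_add_one_self[of 2] by simp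
  have "real (card (grid n (k\<^sup>2 * n))) \<le> 2 ^ (k\<^sup>2 * n) * 3 ^ n" by (rule card_grid)
  also have "\<dots> \<le> exp 1 ^ (k\<^sup>2 * n) * exp 2 ^ n"
    using \<open>2 \<le> exp 1\<close> \<open>3 \<le> exp 2\<close> by (intro mult_mono power_mono) auto
  also have "\<dots> = exp ((real (k\<^sup>2) + 2) * real n)"
    by (simp add: exp_of_nat_mult[symmetric] exp_add[symmetric] algebra_simps)
  finally show ?thesis .
qed

theorem theorem1:
  fixes lm lp \<delta>0 :: real
  assumes "lm < 0" and "lp > 0" and "0 < \<delta>0" and "\<delta>0 < 1"
  shows "\<exists>c0 C0 :: real. c0 > 0 \<and>
    (\<forall>n m :: nat. \<forall>x :: nat \<Rightarrow> real.
       (\<forall>j\<ge>n. x j = 0) \<longrightarrow> (\<exists>j<n. x j \<noteq> 0) \<longrightarrow> real m \<ge> C0 * real n \<longrightarrow>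
       (\<exists>A \<in> sets (gauss_sample m n).
          measure (gauss_sample m n) A \<ge> 1 - 10 * exp (- c0 * real m) \<and>
          (\<forall>\<omega>\<in>A. \<forall>d. is_dhat lm lp m n \<omega> x d \<longrightarrow>
             pdist n (\<lambda>j. rhat m n \<omega> x * d j) x \<le> \<delta>0 * vnorm n x)))"
proof -
  define q where "q = \<delta>0 * (- lm) / (lp - lm)"
  define \<epsilon> where "\<epsilon> = q / 33"
  have \<epsilon>0: "0 < \<epsilon>"
    unfolding \<epsilon>_def q_def using assms by (intro divide_pos_pos mult_pos_pos) auto
  have "q * (lp - lm) = \<delta>0 * (- lm)" using assms by (simp add: q_def)
  then have "33 * (\<epsilon> * (lp - lm)) = \<delta>0 * (- lm)" by (simp add: \<epsilon>_def)
  then have \<epsilon>l: "33 * \<epsilon> * (lp - lm) \<le> \<delta>0 * (- lm)" by (simp only: mult.assoc)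
  have "\<delta>0 * (- lm) \<le> 1 * (- lm)" using assms by (intro mult_right_mono) auto
  also have "\<dots> \<le> 1 * (lp - lm)" using assms by simp
  finally have "\<delta>0 * (- lm) \<le> 1 * (lp - lm)" .
  moreover have "0 < lp - lm" using assms by simp
  ultimately have "q \<le> 1" by (simp only: q_def pos_divide_le_eq)
  then have "\<epsilon> \<le> 1" by (simp add: \<epsilon>_def)
  define k where "k = nat \<lceil>10 / \<epsilon>\<rceil>"
  have "10 / \<epsilon> \<le> real k" unfolding k_def by linarith
  moreover have "0 < 10 / \<epsilon>" using \<epsilon>0 by simp
  ultimately have "0 < real k" by linarith
  with \<open>10 / \<epsilon> \<le> real k\<close> have k: "0 < k" "1 / real k \<le> \<epsilon> / 10"
    using \<epsilon>0 by (simp_all add: field_simps)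
  obtain \<kappa> where \<kappa>: "0 < \<kappa>" "\<kappa> \<le> 1" and typical:
    "\<And>m n e \<epsilon>. vnorm n e = 1 \<Longrightarrow> 0 < \<epsilon> \<Longrightarrow> \<epsilon> \<le> 1 \<Longrightarrow>
    emeasure (gauss_sample m n) {\<omega> \<in> space (gauss_sample m n). \<not> typical m \<kappa> \<epsilon> (\<lambda>i. vinner n (avec \<omega> i) e)}
      \<le> ennreal (2 * exp (- (\<epsilon>\<^sup>2 / 16) * real m) + 2 * exp (- \<kappa> * real m))"
    by (rule gauss_sample_typical) (rule that)
  \<comment> \<open>The rate of a single bad pair at accuracy \<open>\<epsilon> / 10\<close>. It is
    below both rates for atypical \<open>X\<close>, so it serves for all failure events.\<close>
  define c where "c = (\<epsilon> / 10)\<^sup>2 * \<kappa>\<^sup>2 / 16"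
  define D where "D = real (k\<^sup>2) + 2"
  have c: "0 < c" "c \<le> \<epsilon>\<^sup>2 / 16" "c \<le> \<kappa>"
  proof -
    have k2: "\<kappa>\<^sup>2 \<le> \<kappa>" "\<kappa>\<^sup>2 \<le> 1" using \<kappa> by (auto simp: power2_eq_square mult_left_le mult_le_one)
    have e2: "(\<epsilon> / 10)\<^sup>2 \<le> 1" "(\<epsilon> / 10)\<^sup>2 \<le> \<epsilon>\<^sup>2"
      using \<epsilon>0 \<open>\<epsilon> \<le> 1\<close> by (auto simp: power_le_one intro!: power_mono)
    show "0 < c" using \<epsilon>0 \<kappa> by (simp add: c_def)
    have "(\<epsilon> / 10)\<^sup>2 * \<kappa>\<^sup>2 \<le> \<epsilon>\<^sup>2 * 1" using k2 e2 by (intro mult_mono) auto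
    then show "c \<le> \<epsilon>\<^sup>2 / 16" by (simp add: c_def)
    have "(\<epsilon> / 10)\<^sup>2 * \<kappa>\<^sup>2 \<le> 1 * \<kappa>" using k2 e2 \<kappa> by (intro mult_mono) auto
    then show "c \<le> \<kappa>" using \<kappa> by (simp add: c_def)
  qed
  \<comment> \<open>With this constant \<open>(D + 1) * n \<le> c / 2 * m\<close>: half of the
    exponent pays for the net of size at most \<open>exp (D * n)\<close> and, as
    \<open>n \<ge> 1\<close>, leaves a further factor \<open>exp (- 1)\<close>.\<close>
  define C0 where "C0 = 2 * (D + 1) / c"
  have D: "2 \<le> D" by (simp add: D_def)
  have main: "\<exists>A\<in>sets (gauss_sample m n). 1 - 10 * exp (- (c / 2) * real m) \<le> measure (gauss_sample m n) A \<and>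
        (\<forall>\<omega>\<in>A. \<forall>d. is_dhat lm lp m n \<omega> x d \<longrightarrow>
          pdist n (\<lambda>j. rhat m n \<omega> x * d j) x \<le> \<delta>0 * vnorm n x)"
    if x0: "\<forall>j\<ge>n. x j = 0" and x1: "\<exists>j<n. x j \<noteq> 0" and mn: "C0 * real n \<le> real m"
    for n m :: nat and x :: "nat \<Rightarrow> real"
  proof -
    let ?G = "gauss_sample m n"
    interpret G: prob_space ?G by (rule prob_space_gauss_sample)
    have n: "0 < n" using x1 by auto
    have "2 * (D + 1) * real n \<le> c * real m"
      using mn c(1) by (simp add: C0_def field_simps)
    then have mD: "D * real n + 1 \<le> c / 2 * real m"
      using n mult_left_mono[of 1 "real n" 1] by (simp add: algebra_simps)
    have "0 \<le> D * real n" using D by simp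
    with mD have m: "0 < m" by (cases "m = 0") auto
    define b where "b = vnorm n x"
    have b: "b > 0"
    proof -
      obtain j where "j < n" "x j \<noteq> 0" using x1 by auto
      then have "0 < (\<Sum>j<n. x j * x j)" by (intro sum_pos2[of _ j]) (auto simp: zero_less_mult_iff linorder_neq_iff)
      then show ?thesis by (simp add: b_def vnorm_def vinner_def)
    qed
    define e where "e = (\<lambda>j. (1 / b) * x j)"
    have e1: "vnorm n e = 1" unfolding e_def vnorm_scale using b by (simp add: b_def)
    have xe: "x j = b * e j" for j using b by (simp add: e_def)
    have e0: "e j = 0" if "n \<le> j" for j using x0 that by (simp add: e_def)
    \<comment> \<open>Grid points whose projection vanishes have no direction and are
      dropped.\<close>
    define N where "N = {v \<in> grid n (k\<^sup>2 * n). vnorm n (netvec n k e v) \<noteq> 0}"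
    have finN: "finite N" by (simp add: N_def finite_grid)
    define B0 where "B0 = {\<omega> \<in> space ?G. \<not> typical m \<kappa> \<epsilon> (\<lambda>i. vinner n (avec \<omega> i) e)}"
    define B where "B v = {\<omega> \<in> space ?G. bad_pair m \<kappa> (\<epsilon> / 10) (\<lambda>i. vinner n (avec \<omega> i) e)
        (\<lambda>i. vinner n (avec \<omega> i) (netdir n k e v))}" for v
    have B0: "B0 \<in> sets ?G" unfolding B0_def by (rule measurable_typical) measurable
    have B: "B v \<in> sets ?G" for v unfolding B_def by (rule measurable_bad_pair) measurable
    have mB0: "measure ?G B0 \<le> 4 * exp (- c * real m)"
    proof -
      have "emeasure ?G B0 \<le> ennreal (2 * exp (- (\<epsilon>\<^sup>2 / 16) * real m) + 2 * exp (- \<kappa> * real m))"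
        unfolding B0_def by (rule typical[OF e1 \<epsilon>0 \<open>\<epsilon> \<le> 1\<close>])
      then have "measure ?G B0 \<le> 2 * exp (- (\<epsilon>\<^sup>2 / 16) * real m) + 2 * exp (- \<kappa> * real m)"
        by (simp add: G.emeasure_eq_measure add_nonneg_nonneg del: ennreal_plus)
      moreover have "c * real m \<le> \<epsilon>\<^sup>2 / 16 * real m" "c * real m \<le> \<kappa> * real m"
        by (rule mult_right_mono[OF c(2)], simp) (rule mult_right_mono[OF c(3)], simp)
      then have "exp (- (\<epsilon>\<^sup>2 / 16) * real m) \<le> exp (- c * real m)"
        "exp (- \<kappa> * real m) \<le> exp (- c * real m)" by auto
      ultimately show ?thesis by linarith
    qed
    have mB: "measure ?G (B v) \<le> 8 * exp (- c * real m)" if "v \<in> N" for v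
    proof -
      have nz: "vnorm n (netvec n k e v) \<noteq> 0" using that by (simp add: N_def)
      have "emeasure ?G (B v) \<le> ennreal (8 * exp (- c * real m))"
        unfolding B_def c_def
        using \<epsilon>0 \<open>\<epsilon> \<le> 1\<close>
        by (intro gauss_sample_bad_pair \<kappa> m e1 netdir_unit_perp[OF e1 nz]) auto
      then show ?thesis by (simp add: G.emeasure_eq_measure)
    qed
    define Bad where "Bad = B0 \<union> (\<Union>v\<in>N. B v)"
    have Bad: "Bad \<in> sets ?G" unfolding Bad_def using B0 B finN by (intro sets.Un sets.finite_UN) auto
    have cN: "real (card N) \<le> exp (D * real n)"
    proof -
      have "card N \<le> card (grid n (k\<^sup>2 * n))"
        unfolding N_def by (intro card_mono finite_grid) auto
      then show ?thesis using card_grid_exp[of n k] by (simp add: D_def)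
    qed
    have "measure ?G Bad \<le> measure ?G B0 + measure ?G (\<Union>v\<in>N. B v)"
      unfolding Bad_def using B0 B finN by (intro measure_Un_le sets.finite_UN) auto
    also have "measure ?G (\<Union>v\<in>N. B v) \<le> (\<Sum>v\<in>N. measure ?G (B v))"
      using finN B by (intro measure_UNION_le) auto
    also have "\<dots> \<le> (\<Sum>v\<in>N. 8 * exp (- c * real m))" by (intro sum_mono mB)
    also have "\<dots> \<le> exp (D * real n) * (8 * exp (- c * real m))"
      using cN by (simp add: mult_right_mono)
    \<comment> \<open>The 4 from atypical \<open>X\<close> and the 8 per net point add up to 12,
      since \<open>exp (D * n)\<close> is at least 1.\<close>
    also have "measure ?G B0 + exp (D * real n) * (8 * exp (- c * real m))
        \<le> 12 * (exp (D * real n) * exp (- c * real m))"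
    proof -
      have "1 * exp (- c * real m) \<le> exp (D * real n) * exp (- c * real m)"
        using D by (intro mult_right_mono) auto
      then show ?thesis using mB0 by linarith
    qed
    also have "\<dots> = 12 * (exp (D * real n - c / 2 * real m) * exp (- (c / 2) * real m))"
      by (simp flip: exp_add)
    also have "\<dots> \<le> 12 * (exp (- 1) * exp (- (c / 2) * real m))"
      using mD by (intro mult_left_mono mult_right_mono) auto
    \<comment> \<open>The spare factor \<open>exp (- 1)\<close> lowers 12 to 6, within the allowed
      10.\<close>
    also have "\<dots> \<le> 12 * (1 / 2 * exp (- (c / 2) * real m))"
    proof (intro mult_left_mono mult_right_mono)
      have "(2::real) \<le> exp 1" using exp_ge_add_one_self[of 1] by simp
      then show "exp (- 1) \<le> (1 / 2 :: real)" by (simp add: exp_minus field_simps)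
    qed auto
    finally have mBad: "measure ?G Bad \<le> 10 * exp (- (c / 2) * real m)"
      using exp_ge_zero[of "- (c / 2) * real m"] by linarith
    show ?thesis
    \<comment> \<open>The event is defined without any maximizer, so its measurability is immediate
      and the bound holds for all maximizers at once.\<close>
    proof (rule bexI[where x="space ?G - Bad"], rule conjI, goal_cases)
      case 1
      show "1 - 10 * exp (- (c / 2) * real m) \<le> measure ?G (space ?G - Bad)"
        using mBad by (simp add: G.prob_compl[OF Bad])
    next
      case 2
      have "pdist n (\<lambda>j. rhat m n \<omega> x * d j) x \<le> \<delta>0 * b"
        if \<omega>: "\<omega> \<in> space ?G - Bad" and d: "is_dhat lm lp m n \<omega> x d" for \<omega> d
        by (rule pdist_le_of_good_event[OF assms(1,2,4) \<epsilon>0 \<epsilon>l m n \<kappa>(1) k xe b e1 e0 _ _ d])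
           (use \<omega> in \<open>auto simp: Bad_def B0_def B_def N_def\<close>)
      then show ?case by (simp add: b_def)
    next
      case 3
      show ?case using Bad by auto
    qed
  qed
  show ?thesis
    by (intro exI[where x="c / 2"] exI[where x=C0] conjI allI impI main) (use c in simp_all)
qed

end
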